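(* Let $\mathcal K$ be a real Hilbert space with scalar product $\langle\cdot,\cdot\rangle$ and norm $\|\cdot\|$. Let $\alpha,\beta\in\,]0,+\infty[$, let $(\eta_n)_{n\in\mathbb N}$ be a summable sequence in $[0,+\infty[$, and let $(U_n)_{n\in\mathbb N}$ be a sequence in $\mathcal B(\mathcal K)$ such that $$\mu=\sup_{n\in\mathbb N}\|U_n\|<+\infty\quad\text{and}\quad (\forall n\in\mathbb N)\ \ (1+\eta_n)U_{n+1}\succcurlyeq U_n\in\mathcal P_\alpha(\mathcal K).$$ Let $A\colon\mathcal K\to2^{\mathcal K}$ be maximally monotone, and let $B\colon\mathcal K\to\mathcal K$ be monotone and $\beta$-Lipschitzian, with $\operatorname{zer}(A+B)\neq\varnothing$. Let $(a_n)_{n\in\mathbb N}$, $(b_n)_{n\in\mathbb N}$, $(c_n)_{n\in\mathbb N}$ be sequences in $\mathcal K$ with $\sum_n\|a_n\|<\infty$, $\sum_n\|b_n\|<\infty$, $\sum_n\|c_n\|<\infty$. Let $x_0\in\mathcal K$, let $\varepsilon\in\,]0,1/(\beta\mu+1)[$, let $(\gamma_n)_{n\in\mathbb N}$ be a sequence in $[\varepsilon,(1-\varepsilon)/(\beta\mu)]$, and for every $n\in\mathbb N$ set $$y_n=x_n-\gamma_nU_n(Bx_n+a_n),\quad p_n=J_{\gamma_nU_nA}y_n+b_n,\quad q_n=p_n-\gamma_nU_n(Bp_n+c_n),\quad x_{n+1}=x_n-y_n+q_n.$$ Then there exists $\overline x\in\operatorname{zer}(A+B)$ such that: (i) $\sum_{n}\|x_n-p_n\|^2<+\infty$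 and $\sum_n\|y_n-q_n\|^2<+\infty$; (ii) $x_n\rightharpoonup\overline x$ and $p_n\rightharpoonup\overline x$; (iii) if one of the following holds: (a) $\liminf_{n} d_{\operatorname{zer}(A+B)}(x_n)=0$; (b) $A+B$ is demiregular at $\overline x$; (c) $A$ or $B$ is uniformly monotone at $\overline x$; (d) $\operatorname{int}\operatorname{zer}(A+B)\neq\varnothing$ and there exists a summable sequence $(\nu_n)_{n\in\mathbb N}$ in $[0,+\infty[$ such that $(\forall n\in\mathbb N)$ $(1+\nu_n)U_n\succcurlyeq U_{n+1}$; then $x_n\to\overline x$ and $p_n\to\overline x$.
   Context: $\mathcal B(\mathcal K)$ is the space of bounded linear operators on $\mathcal K$. For self-adjoint $M_1,M_2\in\mathcal B(\mathcal K)$, $M_1\succcurlyeq M_2$ means $\langle M_1x,x\rangle\ge\langle M_2x,x\rangle$ for all $x$. $\mathcal P_\alpha(\mathcal K)=\{M\in\mathcal B(\mathcal K): M^*=M,\ M\succcurlyeq\alpha\operatorname{Id}\}$. For an operator $T\colon\mathcal K\to2^{\mathcal K}$, $J_T=(\operatorname{Id}+T)^{-1}$ is its resolvent; $\gamma U A$ denotes the operator $x\mapsto \gamma U(Ax)$ (its resolvent is single-valued and everywhere defined when $U\in\mathcal P_\alpha(\mathcal K)$, $\gamma>0$ and $A$ is maximally monotone). $\operatorname{zer}T=\{x:0\in Tx\}$, $d_C$ is the distance to a set $C$, $\rightharpoonup$ denotes weak and $\to$ strong convergence. $T$ is uniformly monotone at $x\in\operatorname{dom}T$ if there is an increasing function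 $\phi\colon[0,+\infty[\to[0,+\infty]$ vanishing only at $0$ with $\langle x-y,u-v\rangle\ge\phi(\|x-y\|)$ for all $u\in Tx$ and $(y,v)\in\operatorname{gra}T$. $T$ is demiregular at $x\in\operatorname{dom}T$ if for every sequence $(x_n,u_n)$ in $\operatorname{gra}T$ and every $u\in Tx$ with $x_n\rightharpoonup x$ and $u_n\to u$, one has $x_n\to x$. *)

theory Defs
  imports "HOL-Analysis.Analysis"
begin

definition monotone_op :: "('a::real_inner \<Rightarrow> 'a set) \<Rightarrow> bool" where
  "monotone_op T \<longleftrightarrow> (\<forall>x y u v. u \<in> T x \<longrightarrow> v \<in> T y \<longrightarrow> 0 \<le> inner (x - y) (u - v))"

definition maximally_monotone :: "('a::real_inner \<Rightarrow> 'a set) \<Rightarrow> bool" where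
  "maximally_monotone T \<longleftrightarrow> monotone_op T \<and>
     (\<forall>T'. monotone_op T' \<and> (\<forall>x. T x \<subseteq> T' x) \<longrightarrow> T' = T)"

definition single_op :: "('a \<Rightarrow> 'a) \<Rightarrow> ('a \<Rightarrow> 'a set)" where
  "single_op B = (\<lambda>x. {B x})"

definition op_plus :: "('a::real_vector \<Rightarrow> 'a set) \<Rightarrow> ('a \<Rightarrow> 'a) \<Rightarrow> ('a \<Rightarrow> 'a set)" where
  "op_plus A B = (\<lambda>x. (\<lambda>u. u + B x) ` A x)"

definition zer :: "('a::real_vector \<Rightarrow> 'a set) \<Rightarrow> 'a set" where
  "zer T = {x. 0 \<in> T x}"

definition dom_op :: "('a \<Rightarrow> 'b set) \<Rightarrow> 'a set" where
  "dom_op T = {x. T x \<noteq> {}}"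

definition scaled_op :: "real \<Rightarrow> ('a::real_normed_vector \<Rightarrow>\<^sub>L 'a) \<Rightarrow> ('a \<Rightarrow> 'a set) \<Rightarrow> ('a \<Rightarrow> 'a set)" where
  "scaled_op \<gamma> U A = (\<lambda>x. (\<lambda>u. \<gamma> *\<^sub>R blinfun_apply U u) ` A x)"

text \<open>Resolvent J_T = (Id + T)^{-1}, evaluated as the (unique) point x with y in x + T x.\<close>
definition resolvent :: "('a::real_vector \<Rightarrow> 'a set) \<Rightarrow> 'a \<Rightarrow> 'a" where
  "resolvent T y = (THE x. y - x \<in> T x)"

definition selfadjoint :: "('a::real_inner \<Rightarrow>\<^sub>L 'a) \<Rightarrow> bool" where
  "selfadjoint M \<longleftrightarrow> (\<forall>x y. inner (blinfun_apply M x) y = inner x (blinfun_apply M y))"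

definition loewner_ge :: "('a::real_inner \<Rightarrow>\<^sub>L 'a) \<Rightarrow> ('a \<Rightarrow>\<^sub>L 'a) \<Rightarrow> bool" where
  "loewner_ge M1 M2 \<longleftrightarrow> (\<forall>x. inner (blinfun_apply M2 x) x \<le> inner (blinfun_apply M1 x) x)"

definition P_alpha :: "real \<Rightarrow> ('a::real_inner \<Rightarrow>\<^sub>L 'a) set" where
  "P_alpha \<alpha> = {M. selfadjoint M \<and> loewner_ge M (\<alpha> *\<^sub>R id_blinfun)}"

definition weakly_converges :: "(nat \<Rightarrow> 'a::real_inner) \<Rightarrow> 'a \<Rightarrow> bool" where
  "weakly_converges x l \<longleftrightarrow> (\<forall>z. (\<lambda>n. inner (x n) z) \<longlonglongrightarrow> inner l z)"

definition uniformly_monotone_at :: "('a::real_inner \<Rightarrow> 'a set) \<Rightarrow> 'a \<Rightarrow> bool" where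
  "uniformly_monotone_at T x \<longleftrightarrow> x \<in> dom_op T \<and>
     (\<exists>\<phi>::real \<Rightarrow> ereal. mono_on {0..} \<phi> \<and> (\<forall>t\<ge>0. 0 \<le> \<phi> t) \<and>
        (\<forall>t\<ge>0. \<phi> t = 0 \<longleftrightarrow> t = 0) \<and>
        (\<forall>u \<in> T x. \<forall>y v. v \<in> T y \<longrightarrow> \<phi> (norm (x - y)) \<le> ereal (inner (x - y) (u - v))))"

definition demiregular_at :: "('a::real_inner \<Rightarrow> 'a set) \<Rightarrow> 'a \<Rightarrow> bool" where
  "demiregular_at T x \<longleftrightarrow> x \<in> dom_op T \<and>
     (\<forall>xs us u. (\<forall>n. us n \<in> T (xs n)) \<longrightarrow> u \<in> T x \<longrightarrow>
        weakly_converges xs x \<longrightarrow> us \<longlonglongrightarrow> u \<longrightarrow> xs \<longlonglongrightarrow> x)"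

end

theory Submission
  imports Defs "HOL-Library.Diagonal_Subsequence"
begin

text \<open>
  With \<open>V\<^sub>n\<close> the inverse of \<open>U\<^sub>n\<close> and \<open>p'\<^sub>n\<close>, \<open>x'\<^sub>n\<close> the error-free intermediate point and update computed
  from \<open>x\<^sub>n\<close>, Tseng's estimate shows that the step \<open>x\<^sub>n - x'\<^sub>n\<close> equals \<open>\<gamma>\<^sub>n U\<^sub>n v\<^sub>n\<close> with
  \<open>v\<^sub>n \<in> (A + B) p'\<^sub>n\<close>, and that it decreases the squared \<open>V\<^sub>n\<close>-distance to each zero by at least a multiple of
  \<open>\<parallel>x\<^sub>n - p'\<^sub>n\<parallel>\<^sup>2\<close>. The errors are summable, so Young's inequality turns this into a quasi-Fejer
  inequality for squared distances whose constants do not depend on the zero; this gives (i) and \<open>v\<^sub>n \<longlonglongrightarrow> 0\<close>.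
  As \<open>V\<^sub>n\<close> is decreasing up to summable factors, it converges strongly, and Opial's argument
  gives (ii). Existence of the resolvent points is Minty's theorem, obtained
  from the Fitzpatrick function by minimizing a strongly convex function. Maximality of \<open>A + B\<close> is replaced
  by a Banach fixed point argument.
\<close>

section \<open>Selfadjoint elliptic operators\<close>

text \<open>The operator U A need not be monotone for the given scalar product, but it is for the
  one induced by V = U^{-1}, where the resolvent becomes firmly nonexpansive. Distances are
  therefore measured in metrics that change with n; inversion reverses the Loewner order, so each
  change costs a factor 1 + \<eta>_n. The error b_n is added after the resolvent, so p_n may leave
  the domain of A; only the exact point p'_n carries an element of (A + B) p'_n. Independence of the
  zero matters because criteria (a) and (d) test the inequality at zeros that vary along the
  sequence. The bounds on \<gamma>_n have separate roles: the upper one keeps the decrease constant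
  (1 - (1 - \<epsilon>)^2) / \<mu> positive, the lower one makes v_n small when the step is small.
  Of A + B as an operator, weak convergence uses one fact: if (z, 0) is monotonically related to its
  graph, then z is a zero. \<open>elliptic\<close> keeps its bounds explicit because every estimate
  must be uniform in n, and it speaks of plain functions so that inverses and pointwise limits
  fit.\<close>

definition elliptic :: "real \<Rightarrow> real \<Rightarrow> ('a::real_inner \<Rightarrow> 'a) \<Rightarrow> bool" where
  "elliptic m M L \<longleftrightarrow> linear L \<and> (\<forall>x y. inner (L x) y = inner x (L y)) \<and>
     (\<forall>x. m * (norm x)\<^sup>2 \<le> inner (L x) x) \<and> (\<forall>x. norm (L x) \<le> M * norm x)"

lemma elliptic_linear: "elliptic m M L \<Longrightarrow> linear L"
  and elliptic_sym: "elliptic m M L \<Longrightarrow> inner (L x) y = inner x (L y)"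
  and elliptic_lower: "elliptic m M L \<Longrightarrow> m * (norm x)\<^sup>2 \<le> inner (L x) x"
  and elliptic_norm: "elliptic m M L \<Longrightarrow> norm (L x) \<le> M * norm x"
  by (auto simp: elliptic_def)

lemma elliptic_bounded_linear:
  assumes "elliptic m M L" shows "bounded_linear L"
  using elliptic_linear[OF assms] elliptic_norm[OF assms]
  by (intro bounded_linear_intro[where K=M]) (auto simp: linear_iff mult.commute)

lemma elliptic_upper:
  assumes "elliptic m M L"
  shows "inner (L x) x \<le> M * (norm x)\<^sup>2"
proof -
  have "inner (L x) x \<le> norm (L x) * norm x" by (rule norm_cauchy_schwarz)
  also have "\<dots> \<le> M * norm x * norm x"
    by (intro mult_right_mono elliptic_norm[OF assms]) auto
  finally show ?thesis by (simp add: power2_eq_square mult.assoc)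
qed

lemmas elliptic_simps = linear_add[OF elliptic_linear] linear_diff[OF elliptic_linear]
  linear_scale[OF elliptic_linear] linear_0[OF elliptic_linear]

lemma elliptic_add_square:
  assumes "elliptic m M L"
  shows "inner (L (x + y)) (x + y) = inner (L x) x + 2 * inner (L x) y + inner (L y) y"
  using elliptic_sym[OF assms, of y x]
  by (simp add: elliptic_simps[OF assms] inner_add_left inner_add_right inner_commute)

lemma elliptic_diff_square:
  assumes "elliptic m M L"
  shows "inner (L (x - y)) (x - y) = inner (L x) x - 2 * inner (L x) y + inner (L y) y"
  using elliptic_sym[OF assms, of y x]
  by (simp add: elliptic_simps[OF assms] inner_diff_left inner_diff_right inner_commute)

lemma elliptic_scale_square:
  assumes "elliptic m M L"
  shows "inner (L (s *\<^sub>R x)) (s *\<^sub>R x) = s\<^sup>2 * inner (L x) x"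
  by (simp add: elliptic_simps[OF assms] power2_eq_square)

text \<open>\<open>S\<close> plays the role of an epigraph, so a convex function with infinite
  values enters through a closed convex set alone. Ellipticity makes minimizing sequences Cauchy,
  and the conclusion is the first-order condition at the minimizer.\<close>

lemma quadratic_minimizer:
  fixes L :: "'a::{real_inner,complete_space} \<Rightarrow> 'a" and S :: "('a \<times> real) set"
  assumes ell: "elliptic m M L" and m: "0 < m"
    and S: "closed S" "convex S" "S \<noteq> {}"
    and bdd: "\<And>z t. (z, t) \<in> S \<Longrightarrow> k \<le> t + inner (L z) z / 2"
  obtains z0 t0 where "(z0, t0) \<in> S"
    "\<And>z t. (z, t) \<in> S \<Longrightarrow> 0 \<le> t - t0 + inner (L z0) (z - z0)"
proof -
  define f where "f w = snd w + inner (L (fst w)) (fst w) / 2" for w :: "'a \<times> real"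
  define I where "I = Inf (f ` S)"
  have bb: "bdd_below (f ` S)"
    using bdd by (auto simp: f_def intro!: bdd_belowI2[where m=k])
  have Ile: "I \<le> f w" if "w \<in> S" for w
    unfolding I_def using that bb by (intro cInf_lower) auto
  have "\<exists>w\<in>S. f w < I + 1 / real (Suc n)" for n
  proof -
    have "Inf (f ` S) < I + 1 / real (Suc n)" by (simp add: I_def)
    then show ?thesis using cInf_lessD[of "f ` S"] S(3) by blast
  qed
  then obtain w where wS: "\<And>n. w n \<in> S" and wf: "\<And>n. f (w n) < I + 1 / real (Suc n)"
    by metis
  define z where "z n = fst (w n)" for n
  define t where "t n = snd (w n)" for n
  have w_eq: "w n = (z n, t n)" for n by (simp add: z_def t_def)
  have bl: "bounded_linear L" by (rule elliptic_bounded_linear[OF ell])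
  \<comment> \<open>The midpoint of two near-minimizers lies in \<open>S\<close>, so its value is at
    least \<open>I\<close>; the parallelogram identity converts this into a bound of
    \<open>z i - z j\<close> by the two excesses.\<close>
  have key: "m * (norm (z i - z j))\<^sup>2 \<le> 4 * (1 / real (Suc i) + 1 / real (Suc j))" for i j
  proof -
    have "(1/2) *\<^sub>R w i + (1/2) *\<^sub>R w j \<in> S"
      using S(2) wS by (intro convexD) auto
    from Ile[OF this] have "I \<le> (t i + t j)/2 + inner (L (z i + z j)) (z i + z j) / 8"
      by (simp add: f_def w_eq elliptic_simps[OF ell] flip: scaleR_right_distrib)
        (simp add: algebra_simps add_divide_distrib)
    moreover have "inner (L (z i + z j)) (z i + z j) + inner (L (z i - z j)) (z i - z j)
       = 2 * inner (L (z i)) (z i) + 2 * inner (L (z j)) (z j)"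
      by (simp add: elliptic_add_square[OF ell] elliptic_diff_square[OF ell])
    moreover have "m * (norm (z i - z j))\<^sup>2 \<le> inner (L (z i - z j)) (z i - z j)"
      by (rule elliptic_lower[OF ell])
    moreover have "X \<le> 4 * (u + v)"
      if "I \<le> (a + b) / 2 + P / 8" "P + N = 2 * c + 2 * d" "X \<le> N"
        "a + c / 2 < I + u" "b + d / 2 < I + v" for X N P a b c d u v :: real
      using that by (simp add: field_simps)
    ultimately show ?thesis using wf[of i] wf[of j] unfolding f_def w_eq fst_conv snd_conv by blast
  qed
  have "Cauchy z"
  proof (rule metric_CauchyI)
    fix e :: real assume e: "0 < e"
    have "0 < e\<^sup>2 * m / 8" using e m by simp
    then obtain N where N: "1 / real (Suc N) < e\<^sup>2 * m / 8"
      using nat_approx_posE by metis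
    have "dist (z i) (z j) < e" if "i \<ge> N" "j \<ge> N" for i j
    proof -
      have "1 / real (Suc i) \<le> 1 / real (Suc N)" "1 / real (Suc j) \<le> 1 / real (Suc N)"
        using that by (auto intro!: divide_left_mono)
      with key[of i j] N have "m * (norm (z i - z j))\<^sup>2 < m * e\<^sup>2" by (simp add: mult.commute)
      then have "(norm (z i - z j))\<^sup>2 < e\<^sup>2" using m by simp
      then show ?thesis using e by (simp add: dist_norm power2_less_imp_less)
    qed
    then show "\<exists>N. \<forall>i\<ge>N. \<forall>j\<ge>N. dist (z i) (z j) < e" by blast
  qed
  then obtain z0 where z0: "z \<longlonglongrightarrow> z0" by (auto simp: Cauchy_convergent_iff convergent_def)
  have Lz: "(\<lambda>n. inner (L (z n)) (z n)) \<longlonglongrightarrow> inner (L z0) z0"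
    by (intro tendsto_intros bounded_linear.tendsto[OF bl] z0)
  have ft: "(\<lambda>n. f (w n)) \<longlonglongrightarrow> I"
  proof (rule tendsto_sandwich[of "\<lambda>n. I" _ _ "\<lambda>n. I + 1 / real (Suc n)"])
    show "(\<lambda>n. I + 1 / real (Suc n)) \<longlonglongrightarrow> I"
      using tendsto_add[OF tendsto_const LIMSEQ_Suc[OF lim_1_over_n], of I] by simp
  qed (use Ile wS wf in \<open>auto intro!: always_eventually less_imp_le\<close>)
  \<comment> \<open>The heights \<open>t n\<close> have no bound of their own; their limit is forced
    by that of \<open>f (w n)\<close> and the continuity of the quadratic form.\<close>
  define t0 where "t0 = I - inner (L z0) z0 / 2"
  have "(\<lambda>n. f (w n) - inner (L (z n)) (z n) / 2) \<longlonglongrightarrow> t0"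
    unfolding t0_def by (intro tendsto_intros ft Lz) auto
  then have "t \<longlonglongrightarrow> t0" by (simp add: f_def w_eq)
  with z0 have "(\<lambda>n. (z n, t n)) \<longlonglongrightarrow> (z0, t0)" by (intro tendsto_Pair)
  moreover have "(z n, t n) \<in> S" for n using wS[of n] by (simp add: w_eq)
  ultimately have in_S: "(z0, t0) \<in> S" using closed_sequentially[OF S(1)] by meson
  have f0: "f (z0, t0) = I" by (simp add: f_def t0_def)
  have "0 \<le> t' - t0 + inner (L z0) (z' - z0)" if zt: "(z', t') \<in> S" for z' t'
  proof -
    let ?D = "t' - t0 + inner (L z0) (z' - z0)" and ?q = "inner (L (z' - z0)) (z' - z0)"
    \<comment> \<open>Moving from the minimizer by a fraction \<open>s\<close> towards
      \<open>(z', t')\<close> changes \<open>f\<close> by \<open>s * (?D + s * ?q / 2)\<close>;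
      dividing by \<open>s\<close> and letting it tend to 0 leaves \<open>?D\<close>.\<close>
    have "0 \<le> ?D + s * ?q / 2" if s: "0 < s" "s < 1" for s
    proof -
      have "(1 - s) *\<^sub>R (z0, t0) + s *\<^sub>R (z', t') \<in> S"
        using S(2) in_S zt s by (intro convexD) auto
      also have "(1 - s) *\<^sub>R (z0, t0) + s *\<^sub>R (z', t') = (z0 + s *\<^sub>R (z' - z0), t0 + s * (t' - t0))"
        by (simp add: algebra_simps)
      finally have "f (z0, t0) \<le> f (z0 + s *\<^sub>R (z' - z0), t0 + s * (t' - t0))"
        using Ile f0 by simp
      then have "0 \<le> s * (t' - t0) + s * inner (L z0) (z' - z0) + s\<^sup>2 * ?q / 2"
        unfolding f_def fst_conv snd_conv elliptic_add_square[OF ell] elliptic_scale_square[OF ell]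
        by (simp add: add_divide_distrib)
      also have "\<dots> = s * (?D + s * ?q / 2)" by (simp add: algebra_simps power2_eq_square)
      finally show ?thesis using s by (simp add: zero_le_mult_iff)
    qed
    then have "eventually (\<lambda>s. 0 \<le> ?D + s * ?q / 2) (at_right 0)"
      by (auto simp: eventually_at_right_field intro!: exI[of _ 1])
    moreover have "((\<lambda>s. ?D + s * ?q / 2) \<longlongrightarrow> ?D + 0 * ?q / 2) (at_right 0)"
      by (intro tendsto_intros) auto
    ultimately show ?thesis
      using tendsto_lowerbound[of _ "?D + 0 * ?q / 2" "at_right (0::real)" 0] by simp
  qed
  with in_S show ?thesis using that by blast
qed

text \<open>Minimizing half the quadratic form minus \<open>\<phi>\<close> over \<open>W\<close>
  gives an inequality in each direction \<open>w\<close>; the direction \<open>- w\<close> turns it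
  into an equality. The relative form serves three times: for surjectivity of \<open>L\<close>, for
  representing a functional known only on \<open>W\<close>, and for the orthogonal projection onto
  \<open>W\<close>.\<close>

lemma lax_milgram_subspace:
  fixes L :: "'a::{real_inner,complete_space} \<Rightarrow> 'a"
  assumes ell: "elliptic m M L" and m: "0 < m"
    and W: "closed W" "subspace W"
    and phi: "\<And>u v. u \<in> W \<Longrightarrow> v \<in> W \<Longrightarrow> \<phi> (u + v) = \<phi> u + \<phi> v"
      "\<And>r u. u \<in> W \<Longrightarrow> \<phi> (r *\<^sub>R u) = r * \<phi> u"
      "\<And>u. u \<in> W \<Longrightarrow> \<bar>\<phi> u\<bar> \<le> K * norm u"
  obtains w0 where "w0 \<in> W" "\<And>w. w \<in> W \<Longrightarrow> inner (L w0) w = \<phi> w"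
proof -
  define S where "S = {(w, t). w \<in> W \<and> - \<phi> w \<le> t}"
  have phi_diff: "\<phi> (u - v) = \<phi> u - \<phi> v" if "u \<in> W" "v \<in> W" for u v
    using phi(1)[of u "- v"] phi(2)[of v "-1"] that subspace_neg[OF W(2)] by simp
  have "closed S"
  unfolding closed_sequential_limits
  proof clarify
    fix f w t assume f: "\<forall>n. f n \<in> S" and lim: "f \<longlonglongrightarrow> (w, t)"
    have l1: "(\<lambda>n. fst (f n)) \<longlonglongrightarrow> w" and l2: "(\<lambda>n. snd (f n)) \<longlonglongrightarrow> t"
      using tendsto_fst[OF lim] tendsto_snd[OF lim] by auto
    have wn: "fst (f n) \<in> W" "- \<phi> (fst (f n)) \<le> snd (f n)" for n
      using spec[OF f, of n] by (auto simp: S_def split: prod.splits)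
    have w: "w \<in> W" by (rule closed_sequentially[OF W(1) wn(1) l1])
    have "(\<lambda>n. \<phi> (fst (f n)) - \<phi> w) \<longlonglongrightarrow> 0"
    proof (rule Lim_null_comparison)
      show "eventually (\<lambda>n. norm (\<phi> (fst (f n)) - \<phi> w) \<le> K * norm (fst (f n) - w)) sequentially"
        using phi(3)[OF subspace_diff[OF W(2) wn(1) w]] phi_diff[OF wn(1) w] by simp
      show "(\<lambda>n. K * norm (fst (f n) - w)) \<longlonglongrightarrow> 0"
        using tendsto_mult[OF tendsto_const tendsto_norm[OF tendsto_diff[OF l1 tendsto_const]], of K w] by simp
    qed
    then have "(\<lambda>n. \<phi> (fst (f n))) \<longlonglongrightarrow> \<phi> w" by (simp add: LIM_zero_iff)
    from LIMSEQ_le[OF tendsto_minus[OF this] l2] wn(2) have "- \<phi> w \<le> t" by auto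
    with w show "(w, t) \<in> S" by (simp add: S_def)
  qed
  moreover have "convex S"
  proof (rule convexI)
    fix P Q and r s :: real
    assume *: "P \<in> S" "Q \<in> S" "0 \<le> r" "0 \<le> s" "r + s = 1"
    obtain w t w' t' where PQ: "P = (w, t)" "Q = (w', t')" by fastforce
    have W': "w \<in> W" "w' \<in> W" using * PQ by (auto simp: S_def)
    have "r * - \<phi> w \<le> r * t" "s * - \<phi> w' \<le> s * t'"
      using * PQ unfolding S_def by (intro mult_left_mono; simp)+
    then show "r *\<^sub>R P + s *\<^sub>R Q \<in> S"
      using W' PQ by (simp add: S_def phi subspace_add[OF W(2)] subspace_scale[OF W(2)])
  qed
  moreover have "(0, 0) \<in> S" using phi(2)[of 0 0] subspace_0[OF W(2)] by (simp add: S_def)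
  then have "S \<noteq> {}" by blast
  \<comment> \<open>Completing the square in \<open>norm z\<close>, whose minimum is at
    \<open>K / m\<close>.\<close>
  moreover have "- (K\<^sup>2 / (2 * m)) \<le> t + inner (L z) z / 2" if "(z, t) \<in> S" for z t
  proof -
    have "- (K * norm z) \<le> t" using that phi(3)[of z] by (auto simp: S_def)
    moreover have "m * (norm z)\<^sup>2 \<le> inner (L z) z" by (rule elliptic_lower[OF ell])
    moreover have "0 \<le> (K / m - norm z)\<^sup>2 * m / 2" using m by simp
    moreover have "(K / m - norm z)\<^sup>2 * m / 2 = K\<^sup>2 / (2 * m) - K * norm z + m * (norm z)\<^sup>2 / 2"
      using m by (simp add: power2_eq_square field_simps)
    ultimately show ?thesis by linarith
  qed
  ultimately obtain z0 t0 where z0: "(z0, t0) \<in> S"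
    and opt: "\<And>z t. (z, t) \<in> S \<Longrightarrow> 0 \<le> t - t0 + inner (L z0) (z - z0)"
    using quadratic_minimizer[OF ell m] by metis
  have z0W: "z0 \<in> W" using z0 by (simp add: S_def)
  have ge: "\<phi> w \<le> inner (L z0) w" if w: "w \<in> W" for w
  proof -
    have "(z0 + w, - \<phi> (z0 + w)) \<in> S" using w z0W by (simp add: S_def subspace_add[OF W(2)])
    from opt[OF this] z0 show ?thesis using phi(1)[OF z0W w] by (simp add: S_def)
  qed
  have "inner (L z0) w = \<phi> w" if w: "w \<in> W" for w
    using ge[OF w] ge[OF subspace_neg[OF W(2) w]] phi(2)[OF w, of "-1"] by simp
  with z0W show ?thesis using that by blast
qed

lemma elliptic_id: "elliptic 1 1 (\<lambda>x. x)"
  by (simp add: elliptic_def power2_norm_eq_inner linear_id[unfolded id_def])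

section \<open>Inverses of elliptic operators and reversal of the Loewner order\<close>

lemma elliptic_surj:
  fixes L :: "'a::{real_inner,complete_space} \<Rightarrow> 'a"
  assumes ell: "elliptic m M L" and m: "0 < m"
  shows "surj L"
proof -
  have "\<exists>x. L x = y" for y
  proof -
    obtain w0 where "\<And>w. w \<in> UNIV \<Longrightarrow> inner (L w0) w = inner y w"
      using lax_milgram_subspace[OF ell m, of UNIV "\<lambda>w. inner y w" "norm y"]
      by (auto simp: inner_add_right Cauchy_Schwarz_ineq2)
    then have "L w0 = y" by (metis UNIV_I vector_eq_rdot)
    then show ?thesis ..
  qed
  then show ?thesis by (metis surjI)
qed

lemma elliptic_inj:
  assumes ell: "elliptic m M L" and m: "0 < m"
  shows "inj L"
proof (rule linear_injective_0[OF elliptic_linear[OF ell], THEN iffD2], clarify)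
  fix x assume "L x = 0"
  then have "m * (norm x)\<^sup>2 \<le> 0" using elliptic_lower[OF ell, of x] by simp
  then show "x = 0" using m by (simp add: mult_le_0_iff)
qed

lemma elliptic_inv_apply:
  fixes L :: "'a::{real_inner,complete_space} \<Rightarrow> 'a"
  assumes "elliptic m M L" and "0 < m"
  shows "L (inv L x) = x" "inv L (L x) = x"
  using elliptic_surj[OF assms] elliptic_inj[OF assms] by (auto simp: surj_f_inv_f)

text \<open>The quadratic form of the inverse is the supremum over \<open>z\<close> of the left-hand
  side, attained at \<open>z = inv L x\<close>. This variational description replaces square roots
  of operators in what follows.\<close>

lemma elliptic_inv_ge:
  fixes L :: "'a::{real_inner,complete_space} \<Rightarrow> 'a"
  assumes "elliptic m M L" and "0 < m"
  shows "2 * inner z x - inner (L z) z \<le> inner (inv L x) x"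
proof -
  have "0 \<le> inner (L (inv L x - z)) (inv L x - z)"
    using elliptic_lower[OF assms(1), of "inv L x - z"] assms(2)
    by (smt (verit) mult_nonneg_nonneg zero_le_power2)
  then show ?thesis
    by (simp add: elliptic_diff_square[OF assms(1)] elliptic_inv_apply[OF assms] inner_commute[of x])
qed

lemma elliptic_inv:
  fixes L :: "'a::{real_inner,complete_space} \<Rightarrow> 'a"
  assumes ell: "elliptic m M L" and m: "0 < m" and M: "0 < M"
  shows "elliptic (1 / M) (1 / m) (inv L)"
  unfolding elliptic_def
proof (intro conjI allI)
  note ap = elliptic_inv_apply[OF ell m]
  show "linear (inv L)"
  proof (rule linearI)
    fix x y r
    have "inv L (L (inv L x + inv L y)) = inv L x + inv L y" "inv L (L (r *\<^sub>R inv L x)) = r *\<^sub>R inv L x"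
      by (simp_all only: ap)
    then show "inv L (x + y) = inv L x + inv L y" "inv L (r *\<^sub>R x) = r *\<^sub>R inv L x"
      by (simp_all add: elliptic_simps[OF ell] ap)
  qed
  fix x y
  show "inner (inv L x) y = inner x (inv L y)"
    using elliptic_sym[OF ell, of "inv L x" "inv L y"] by (simp add: ap)
  \<comment> \<open>The choice z = x / M in the variational bound produces the lower constant 1 /
    M.\<close>
  have "2 * inner ((1/M) *\<^sub>R x) x - inner (L ((1/M) *\<^sub>R x)) ((1/M) *\<^sub>R x) \<le> inner (inv L x) x"
    by (rule elliptic_inv_ge[OF ell m])
  moreover have "inner (L ((1/M) *\<^sub>R x)) ((1/M) *\<^sub>R x) \<le> (1/M) * (norm x)\<^sup>2"
    using elliptic_upper[OF ell, of "(1/M) *\<^sub>R x"] M by (simp add: field_simps power2_eq_square)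
  moreover have "2 * inner ((1/M) *\<^sub>R x) x = 2 * ((1/M) * (norm x)\<^sup>2)"
    by (simp add: power2_norm_eq_inner)
  ultimately show "1 / M * (norm x)\<^sup>2 \<le> inner (inv L x) x" by linarith
  have "m * (norm (inv L x))\<^sup>2 \<le> inner x (inv L x)"
    using elliptic_lower[OF ell, of "inv L x"] by (simp add: ap)
  also have "\<dots> \<le> norm x * norm (inv L x)" by (rule norm_cauchy_schwarz)
  finally have "m * norm (inv L x) \<le> norm x"
    by (cases "inv L x = 0") (simp_all add: power2_eq_square)
  then show "norm (inv L x) \<le> 1 / m * norm x" using m by (simp add: field_simps)
qed

text \<open>For \<open>z = inv L' x\<close> the supremum for \<open>L'\<close> is attained;
  replacing \<open>L'\<close> by \<open>L / r\<close> and rescaling the test vector to z / r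
  compares it with the supremum for \<open>L\<close>.\<close>

lemma elliptic_inv_antimono:
  fixes L L' :: "'a::{real_inner,complete_space} \<Rightarrow> 'a"
  assumes ell: "elliptic m M L" "elliptic m' M' L'" and m: "0 < m" "0 < m'" and r: "0 < r"
    and le: "\<And>x. inner (L x) x \<le> r * inner (L' x) x"
  shows "inner (inv L' x) x \<le> r * inner (inv L x) x"
proof -
  define z where "z = inv L' x"
  have z: "L' z = x" by (simp add: z_def elliptic_inv_apply[OF ell(2) m(2)])
  have "inner (inv L' x) x = 2 * inner z x - inner (L' z) z" by (simp add: z inner_commute) (simp add: z_def inner_commute)
  also have "\<dots> \<le> 2 * inner z x - inner (L z) z / r" using le[of z] r by (simp add: field_simps)
  also have "\<dots> = r * (2 * inner ((1/r) *\<^sub>R z) x - inner (L ((1/r) *\<^sub>R z)) ((1/r) *\<^sub>R z))"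
    using r by (simp add: elliptic_simps[OF ell(1)] right_diff_distrib)
  also have "\<dots> \<le> r * inner (inv L x) x"
    using r by (intro mult_left_mono elliptic_inv_ge[OF ell(1) m(1)]) auto
  finally show ?thesis .
qed

section \<open>Resolvents of maximally monotone operators\<close>

lemma maximally_monotoneD:
  assumes "maximally_monotone A" "u \<in> A x" "v \<in> A y"
  shows "0 \<le> inner (x - y) (u - v)"
  using assms by (auto simp: maximally_monotone_def monotone_op_def)

text \<open>Adding the single pair \<open>(x, u)\<close> to the graph leaves it monotone, so by
  maximality the pair was already there.\<close>

lemma maximally_monotone_memI:
  assumes A: "maximally_monotone A" and rel: "\<And>a b. b \<in> A a \<Longrightarrow> 0 \<le> inner (x - a) (u - b)"
  shows "u \<in> A x"
proof -
  define T where "T = A(x := insert u (A x))"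
  have "0 \<le> inner (z - y) (v - w)" if "v \<in> T z" "w \<in> T y" for z y v w
  proof -
    consider "v \<in> A z" "w \<in> A y" | "z = x" "v = u" "w \<in> A y" | "v \<in> A z" "y = x" "w = u"
      | "z = x" "v = u" "y = x" "w = u"
      using \<open>v \<in> T z\<close> \<open>w \<in> T y\<close> by (auto simp: T_def split: if_splits)
    then show ?thesis
    proof cases
      case 3
      then have "0 \<le> inner (x - z) (u - v)" using rel by blast
      also have "\<dots> = inner (z - y) (v - w)"
        using 3 by (simp add: inner_diff_left inner_diff_right)
      finally show ?thesis .
    qed (use maximally_monotoneD[OF A] rel in auto)
  qed
  then have "monotone_op T" by (simp add: monotone_op_def)
  moreover have "\<forall>z. A z \<subseteq> T z" by (auto simp: T_def)
  ultimately have "T = A" using A by (simp add: maximally_monotone_def)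
  moreover have "u \<in> T x" by (simp add: T_def)
  ultimately show ?thesis by simp
qed

text \<open>The block-diagonal form makes an operator and its inverse, acting on the two
  coordinates, accessible to \<open>quadratic_minimizer\<close> on the product space.\<close>

lemma elliptic_Pair:
  assumes ell: "elliptic m M L" "elliptic m' M' L'" and M: "0 \<le> M" "0 \<le> M'"
  shows "elliptic (min m m') (M + M') (\<lambda>z. (L (fst z), L' (snd z)))"
  unfolding elliptic_def
proof (intro conjI allI)
  show "linear (\<lambda>z. (L (fst z), L' (snd z)))"
    by (rule linearI) (simp_all add: elliptic_simps[OF ell(1)] elliptic_simps[OF ell(2)])
  fix z w
  show "inner (L (fst z), L' (snd z)) w = inner z (L (fst w), L' (snd w))"
    by (simp add: inner_prod_def elliptic_sym[OF ell(1)] elliptic_sym[OF ell(2)])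
  have "min m m' * (norm (fst z))\<^sup>2 \<le> inner (L (fst z)) (fst z)"
       "min m m' * (norm (snd z))\<^sup>2 \<le> inner (L' (snd z)) (snd z)"
    using elliptic_lower[OF ell(1), of "fst z"] elliptic_lower[OF ell(2), of "snd z"]
    by (smt (verit) mult_right_mono zero_le_power2 min.cobounded1 min.cobounded2)+
  then show "min m m' * (norm z)\<^sup>2 \<le> inner (L (fst z), L' (snd z)) z"
    by (simp add: inner_prod_def norm_prod_def distrib_left)
  have "norm (L (fst z), L' (snd z)) \<le> norm (L (fst z)) + norm (L' (snd z))"
    by (rule norm_Pair_le)
  also have "\<dots> \<le> M * norm (fst z) + M' * norm (snd z)"
    by (intro add_mono elliptic_norm[OF ell(1)] elliptic_norm[OF ell(2)])
  also have "\<dots> \<le> M * norm z + M' * norm z"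
    using M by (intro add_mono mult_left_mono) (use norm_fst_le[of "fst z" "snd z"] norm_snd_le[of "snd z" "fst z"] in auto)
  finally show "norm (L (fst z), L' (snd z)) \<le> (M + M') * norm z" by (simp add: distrib_right)
qed

text \<open>The set \<open>S\<close> is the epigraph of the Fitzpatrick function of \<open>A - c\<close>, which dominates
  the duality product; the minimizer of its sum with half the quadratic form of \<open>(inv L, L)\<close>
  is the wanted graph point up to sign.\<close>

lemma minty_elliptic:
  fixes L :: "'a::{real_inner,complete_space} \<Rightarrow> 'a"
  assumes A: "maximally_monotone A" and ell: "elliptic m M L" and m: "0 < m" and M: "0 < M"
  shows "\<exists>p. inv L (y - p) \<in> A p"
proof -
  define V where "V = inv L"
  have V: "elliptic (1 / M) (1 / m) V" unfolding V_def by (rule elliptic_inv[OF ell m M])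
  have VL: "V (L x) = x" for x by (simp add: V_def elliptic_inv_apply[OF ell m])
  have sqV: "inner (V (x + L u)) (x + L u) = inner (V x) x + 2 * inner x u + inner (L u) u" for x u
    using elliptic_add_square[OF V, of x "L u"] elliptic_sym[OF V, of x "L u"]
    by (simp add: VL inner_commute)
  have sq_nonneg: "0 \<le> inner (V x) x" for x
    using elliptic_lower[OF V, of x] M by (smt (verit) divide_nonneg_nonneg mult_nonneg_nonneg zero_le_power2)
  define c where "c = V y"
  \<comment> \<open>For fixed \<open>a\<close> and \<open>b\<close> this is affine in
    \<open>w\<close>, so each condition \<open>g a b w \<le> snd w\<close> cuts out a closed
    half-space.\<close>
  define g where "g a b w = inner (fst (fst w)) (b - c) + inner a (snd (fst w)) - inner a (b - c)"
    for a b and w :: "('a \<times> 'a) \<times> real"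
  define S where "S = (\<Inter>a. \<Inter>b\<in>A a. {w. g a b w \<le> snd w})"
  \<comment> \<open>Either \<open>(x, u + c)\<close> is a graph point, where \<open>g\<close>
    returns the duality product, or maximality yields a graph point with negative product, where
    \<open>g\<close> exceeds it.\<close>
  have Sdual: "inner x u \<le> t" if xut: "((x, u), t) \<in> S" for x u t
  proof (cases "u + c \<in> A x")
    case True
    with xut have "g x (u + c) ((x, u), t) \<le> t" by (auto simp: S_def)
    then show ?thesis by (simp add: g_def)
  next
    case False
    then obtain a b where ab: "b \<in> A a" "inner (x - a) (u + c - b) < 0"
      using maximally_monotone_memI[OF A, of x "u + c"] by force
    with xut have "g a b ((x, u), t) \<le> t" by (auto simp: S_def)
    with ab(2) show ?thesis by (simp add: g_def inner_diff_left inner_diff_right inner_add_right)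
  qed
  have graS: "((a, b - c), inner a (b - c)) \<in> S" if ab: "b \<in> A a" for a b
  proof -
    have "g a' b' ((a, b - c), inner a (b - c)) \<le> inner a (b - c)" if "b' \<in> A a'" for a' b'
      using maximally_monotoneD[OF A ab that]
      by (simp add: g_def inner_diff_left inner_diff_right)
    then show ?thesis by (auto simp: S_def)
  qed
  have "\<exists>a. A a \<noteq> {}"
    using maximally_monotone_memI[OF A, of 0 0] by blast
  then have ne: "S \<noteq> {}" using graS by blast
  have cl: "closed S" unfolding S_def g_def
    by (intro closed_INT ballI closed_Collect_le continuous_intros)
  have cv: "convex S" unfolding S_def
  proof (intro convex_INT convexI, clarsimp)
    fix a b x u t x' u' t' and r s :: real
    assume *: "g a b ((x, u), t) \<le> t" "g a b ((x', u'), t') \<le> t'" "0 \<le> r" "0 \<le> s" "r + s = 1"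
    have "r * inner a (b - c) + s * inner a (b - c) = inner a (b - c)"
      using * by (simp flip: distrib_right)
    then have "g a b ((r *\<^sub>R x + s *\<^sub>R x', r *\<^sub>R u + s *\<^sub>R u'), r * t + s * t')
      = r * g a b ((x, u), t) + s * g a b ((x', u'), t')"
      by (simp add: g_def inner_add_left inner_add_right right_diff_distrib distrib_left)
    also have "\<dots> \<le> r * t + s * t'" using * by (intro add_mono mult_left_mono)
    finally show "g a b ((r *\<^sub>R x + s *\<^sub>R x', r *\<^sub>R u + s *\<^sub>R u'), r * t + s * t') \<le> r * t + s * t'" .
  qed
  have ellQ: "elliptic (min (1 / M) m) (1 / m + M) (\<lambda>z. (V (fst z), L (snd z)))"
    using m M by (intro elliptic_Pair V ell) auto
  \<comment> \<open>By \<open>Sdual\<close> the objective is at least half of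
    \<open>inner (V (x + L u)) (x + L u)\<close>, where \<open>z = (x, u)\<close>.\<close>
  have bdd: "0 \<le> t + inner (V (fst z), L (snd z)) z / 2" if "(z, t) \<in> S" for z t
    using Sdual[of "fst z" "snd z" t] that sqV[of "fst z" "snd z"] sq_nonneg[of "fst z + L (snd z)"]
    by (simp add: inner_prod_def add_divide_distrib)
  obtain z0 t0 where z0: "(z0, t0) \<in> S"
    and opt: "\<And>z t. (z, t) \<in> S \<Longrightarrow> 0 \<le> t - t0 + inner (V (fst z0), L (snd z0)) (z - z0)"
    using quadratic_minimizer[OF ellQ _ cl cv ne bdd] m M by auto
  define x where "x = fst z0"
  define u where "u = snd z0"
  have z0_eq: "z0 = (x, u)" by (simp add: x_def u_def)
  have LV: "inner (L u) (V x) = inner x u"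
    using elliptic_sym[OF V, of x "L u"] by (simp add: VL inner_commute)
  \<comment> \<open>Optimality at graph points together with \<open>inner x u \<le> t0\<close> says
    that \<open>(- L u, c - V x)\<close> is monotonically related to the graph of \<open>A\<close>,
    with the square of \<open>x + L u\<close> as surplus. Maximality puts this pair into the graph,
    and testing it against itself forces the surplus to vanish.\<close>
  have key: "inner (V (x + L u)) (x + L u) \<le> inner (- L u - a) (c - V x - b)" if ab: "b \<in> A a" for a b
  proof -
    have "inner (- L u - a) (c - V x - b) = inner (a + L u) (b - c + V x)"
      by (simp add: inner_diff_left inner_diff_right inner_add_left inner_add_right)
    then show ?thesis
      using opt[OF graS[OF ab]] Sdual[of x u t0] z0 LV sqV[of x u]
      by (simp add: z0_eq inner_prod_def inner_diff_left inner_diff_right inner_add_left inner_add_right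
        inner_commute)
  qed
  then have mem: "c - V x \<in> A (- L u)"
    using sq_nonneg[of "x + L u"] by (intro maximally_monotone_memI[OF A]) fastforce
  have "inner (V (x + L u)) (x + L u) \<le> 0" using key[OF mem] by simp
  then have "(norm (x + L u))\<^sup>2 / M \<le> 0" using elliptic_lower[OF V, of "x + L u"] by simp
  then have "x + L u = 0" using M by (simp add: divide_le_0_iff)
  then have "- L u = x" by (simp add: add_eq_0_iff)
  with mem show ?thesis by (auto simp: c_def V_def[symmetric] elliptic_simps[OF V])
qed

text \<open>The hypothesis is tested at the fixed point \<open>a\<close> of the contraction \<open>J\<^sub>t\<^sub>A \<circ> (\<lambda>a. z - t B a)\<close>,
  for which \<open>z - a \<in> t (A + B) a\<close>.\<close>

lemma maximally_monotone_plus_zero: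
  fixes A :: "'a::{real_inner,complete_space} \<Rightarrow> 'a set"
  assumes A: "maximally_monotone A" and lip: "\<beta>-lipschitz_on UNIV B"
    and rel: "\<And>a w. w \<in> A a \<Longrightarrow> 0 \<le> inner (z - a) (- (w + B a))"
  shows "- B z \<in> A z"
proof -
  \<comment> \<open>Small enough for \<open>t * \<bar>\<beta>\<bar> < 1\<close>; the summand 1 keeps
    the quotient meaningful when the Lipschitz constant is 0.\<close>
  define t where "t = 1 / (2 * (\<bar>\<beta>\<bar> + 1))"
  have t: "0 < t" "t * \<bar>\<beta>\<bar> < 1" by (auto simp: t_def field_simps)
  have ell: "elliptic t t (\<lambda>x. t *\<^sub>R x)"
    using t by (auto simp: elliptic_def power2_norm_eq_inner intro!: linear_scaleR)
  have iv: "inv (\<lambda>x::'a. t *\<^sub>R x) v = (1/t) *\<^sub>R v" for v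
    using elliptic_inv_apply(2)[OF ell t(1), of "(1/t) *\<^sub>R v"] t by simp
  have "\<exists>p. (1/t) *\<^sub>R (y - p) \<in> A p" for y
    using minty_elliptic[OF A ell t(1) t(1)] by (simp add: iv)
  then obtain J where J: "\<And>y. (1/t) *\<^sub>R (y - J y) \<in> A (J y)" by metis
  have Jne: "norm (J y - J y') \<le> norm (y - y')" for y y'
  proof -
    have "0 \<le> inner (J y - J y') ((1/t) *\<^sub>R (y - J y) - (1/t) *\<^sub>R (y' - J y'))"
      by (rule maximally_monotoneD[OF A J J])
    also have "\<dots> = (1/t) * (inner (J y - J y') (y - y') - (norm (J y - J y'))\<^sup>2)"
      by (simp add: power2_norm_eq_inner inner_diff_right inner_diff_left algebra_simps)
    finally have "(norm (J y - J y'))\<^sup>2 \<le> inner (J y - J y') (y - y')"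
      using t by (simp add: zero_le_divide_iff)
    also have "\<dots> \<le> norm (J y - J y') * norm (y - y')" by (rule norm_cauchy_schwarz)
    finally show ?thesis
      by (cases "J y = J y'") (simp_all add: power2_eq_square)
  qed
  have Bl: "norm (B x - B y) \<le> \<bar>\<beta>\<bar> * norm (x - y)" for x y
    using lipschitz_onD[OF lip, of x y] by (simp add: dist_norm) (smt (verit) mult_right_mono norm_ge_zero)
  have "\<exists>!a. J (z - t *\<^sub>R B a) = a"
  proof (rule banach_fix_type[where c="t * \<bar>\<beta>\<bar>"])
    show "\<forall>x y. dist (J (z - t *\<^sub>R B x)) (J (z - t *\<^sub>R B y)) \<le> t * \<bar>\<beta>\<bar> * dist x y"
    proof (intro allI)
      fix x y
      have "norm (J (z - t *\<^sub>R B x) - J (z - t *\<^sub>R B y)) \<le> norm ((z - t *\<^sub>R B x) - (z - t *\<^sub>R B y))"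
        by (rule Jne)
      also have "\<dots> = t * norm (B x - B y)"
        using t by (simp add: norm_minus_commute flip: scaleR_diff_right)
      also have "\<dots> \<le> t * (\<bar>\<beta>\<bar> * norm (x - y))" using t Bl by (intro mult_left_mono) auto
      finally show "dist (J (z - t *\<^sub>R B x)) (J (z - t *\<^sub>R B y)) \<le> t * \<bar>\<beta>\<bar> * dist x y"
        by (simp add: dist_norm mult.assoc)
    qed
  qed (use t in auto)
  then obtain a where a: "J (z - t *\<^sub>R B a) = a" by blast
  define w where "w = (1/t) *\<^sub>R (z - t *\<^sub>R B a - a)"
  have w: "w \<in> A a" using J[of "z - t *\<^sub>R B a"] by (simp add: a w_def)
  have wB: "w + B a = (1/t) *\<^sub>R (z - a)" using t by (simp add: w_def algebra_simps)
  have "0 \<le> inner (z - a) (- (w + B a))" by (rule rel[OF w])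
  also have "\<dots> = - ((1/t) * (norm (z - a))\<^sup>2)" by (simp add: wB power2_norm_eq_inner)
  finally have "(norm (z - a))\<^sup>2 \<le> 0" using t by (simp add: divide_le_0_iff)
  then have "z = a" by simp
  with wB have "w = - B z" by (simp add: eq_neg_iff_add_eq_0)
  with w \<open>z = a\<close> show ?thesis by simp
qed

text \<open>The description by \<open>THE\<close> denotes a point once existence and uniqueness are
  known. Applying the inverse of \<open>U\<close> turns the inclusion into one for \<open>A\<close>
  alone: existence is Minty's theorem for \<open>g U\<close>, and uniqueness follows because two
  solutions have nonpositive \<open>V\<close>-distance squared.\<close>

lemma resolvent_scaled:
  fixes A :: "'a::{real_inner,complete_space} \<Rightarrow> 'a set"
  assumes A: "maximally_monotone A" and ell: "elliptic m M (blinfun_apply U)"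
    and m: "0 < m" and M: "0 < M" and g: "0 < g"
  shows "(1/g) *\<^sub>R inv (blinfun_apply U) (y - resolvent (scaled_op g U A) y)
     \<in> A (resolvent (scaled_op g U A) y)"
proof -
  define V where "V = inv (blinfun_apply U)"
  have V: "elliptic (1 / M) (1 / m) V" unfolding V_def by (rule elliptic_inv[OF ell m M])
  note ap = elliptic_inv_apply[OF ell m, folded V_def]
  have ellg: "elliptic (g * m) (g * M) (\<lambda>x. g *\<^sub>R U x)"
    using elliptic_lower[OF ell] elliptic_norm[OF ell] g elliptic_sym[OF ell]
    by (auto simp: elliptic_def blinfun.bilinear_simps mult.assoc algebra_simps intro!: linearI mult_left_mono)
  have iv: "inv (\<lambda>x. g *\<^sub>R U x) v = (1/g) *\<^sub>R V v" for v
    using elliptic_inv_apply(2)[OF ellg, of "(1/g) *\<^sub>R V v"] g m by (simp add: blinfun.bilinear_simps ap)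
  have mem: "y - p \<in> scaled_op g U A p \<longleftrightarrow> (1/g) *\<^sub>R V (y - p) \<in> A p" for p
  proof
    assume "y - p \<in> scaled_op g U A p"
    then obtain u where "u \<in> A p" "y - p = g *\<^sub>R U u" by (auto simp: scaled_op_def)
    then show "(1/g) *\<^sub>R V (y - p) \<in> A p" using g by (simp add: elliptic_simps[OF V] ap)
  next
    assume *: "(1/g) *\<^sub>R V (y - p) \<in> A p"
    have "y - p = g *\<^sub>R U ((1/g) *\<^sub>R V (y - p))" using g by (simp add: blinfun.bilinear_simps ap)
    with * show "y - p \<in> scaled_op g U A p" unfolding scaled_op_def by blast
  qed
  have "\<exists>p. (1/g) *\<^sub>R V (y - p) \<in> A p"
    using minty_elliptic[OF A ellg, of y] g m M by (simp add: iv)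
  moreover have "p = p'" if "(1/g) *\<^sub>R V (y - p) \<in> A p" "(1/g) *\<^sub>R V (y - p') \<in> A p'" for p p'
  proof -
    have "V (y - p) - V (y - p') = - V (p - p')" by (simp add: elliptic_simps[OF V])
    then have "0 \<le> - ((1/g) * inner (V (p - p')) (p - p'))"
      using maximally_monotoneD[OF A that] by (simp add: inner_commute flip: scaleR_diff_right)
    then have "inner (V (p - p')) (p - p') \<le> 0" using g by (simp add: divide_le_0_iff)
    with elliptic_lower[OF V, of "p - p'"] M have "(norm (p - p'))\<^sup>2 / M \<le> 0" by simp
    then show "p = p'" using M by (simp add: divide_le_0_iff)
  qed
  ultimately have "\<exists>!p. y - p \<in> scaled_op g U A p" unfolding mem by blast
  from theI'[OF this] show ?thesis by (simp add: resolvent_def mem V_def)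
qed

section \<open>Weak convergence and variable metrics\<close>

lemma weakly_converges_unique:
  assumes "weakly_converges x l" "weakly_converges x l'"
  shows "l = l'"
proof -
  have "inner l z = inner l' z" for z
    using assms LIMSEQ_unique unfolding weakly_converges_def by blast
  then show ?thesis by (metis vector_eq_rdot)
qed

lemma tendsto_weakly_converges:
  assumes "x \<longlonglongrightarrow> l" shows "weakly_converges x l"
  using tendsto_inner[OF assms tendsto_const] by (simp add: weakly_converges_def)

lemma weakly_converges_perturb:
  assumes "weakly_converges x l" "(\<lambda>n. x n - y n) \<longlonglongrightarrow> 0"
  shows "weakly_converges y l"
  unfolding weakly_converges_def
proof
  fix z
  have "(\<lambda>n. inner (x n) z - inner (x n - y n) z) \<longlonglongrightarrow> inner l z - inner 0 z"
    using assms tendsto_inner[OF assms(2) tendsto_const]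
    by (intro tendsto_diff) (auto simp: weakly_converges_def)
  then show "(\<lambda>n. inner (y n) z) \<longlonglongrightarrow> inner l z" by (simp add: inner_diff_left)
qed

lemma tendsto_inner_weak_strong:
  assumes x: "weakly_converges x l" and b: "\<And>n. norm (x n) \<le> K" and y: "y \<longlonglongrightarrow> w"
  shows "(\<lambda>n. inner (x n) (y n)) \<longlonglongrightarrow> inner l w"
proof -
  have "(\<lambda>n. inner (x n) (y n - w)) \<longlonglongrightarrow> 0"
  proof (rule Lim_null_comparison)
    show "eventually (\<lambda>n. norm (inner (x n) (y n - w)) \<le> K * norm (y n - w)) sequentially"
      using Cauchy_Schwarz_ineq2 b by (auto intro!: always_eventually order_trans[OF Cauchy_Schwarz_ineq2] mult_right_mono)
    show "(\<lambda>n. K * norm (y n - w)) \<longlonglongrightarrow> 0"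
      using tendsto_mult[OF tendsto_const tendsto_norm[OF tendsto_diff[OF y tendsto_const]], of K w] by simp
  qed
  moreover have "(\<lambda>n. inner (x n) w) \<longlonglongrightarrow> inner l w" using x by (simp add: weakly_converges_def)
  ultimately have "(\<lambda>n. inner (x n) (y n - w) + inner (x n) w) \<longlonglongrightarrow> 0 + inner l w" by (rule tendsto_add)
  then show ?thesis by (simp add: inner_diff_right)
qed

text \<open>No separability is needed: the test vectors for which the diagonal subsequence converges form
  a closed subspace containing the sequence, and its orthogonal complement is annihilated.\<close>

lemma bounded_weakly_convergent_subsequence:
  fixes x :: "nat \<Rightarrow> 'a::{real_inner,complete_space}"
  assumes K: "\<And>n. norm (x n) \<le> K"
  obtains r l where "strict_mono r" "weakly_converges (x \<circ> r) l"
proof -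
  have xK: "\<bar>inner (x n) z\<bar> \<le> K * norm z" for n z
    using K[of n] by (intro order_trans[OF Cauchy_Schwarz_ineq2] mult_right_mono) auto
  interpret subseqs "\<lambda>k s. convergent (\<lambda>i. inner (x (s i)) (x k))"
  proof
    fix k and s :: "nat \<Rightarrow> nat"
    have "bounded (range (\<lambda>i. inner (x (s i)) (x k)))"
      using xK by (auto simp: bounded_iff)
    then obtain l r where "strict_mono r" "((\<lambda>i. inner (x (s i)) (x k)) \<circ> r) \<longlonglongrightarrow> l"
      using bounded_imp_convergent_subsequence by blast
    then show "\<exists>r. strict_mono r \<and> convergent (\<lambda>i. inner (x ((s \<circ> r) i)) (x k))"
      by (auto simp: convergent_def o_def)
  qed
  define d where "d = diagseq"
  define W where "W = {z. convergent (\<lambda>i. inner (x (d i)) z)}"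
  have xW: "x k \<in> W" for k
  proof -
    have "convergent (\<lambda>i. inner (x ((diagseq \<circ> (+) (Suc k)) i)) (x k))"
      using convergent_subseq_convergent by (intro diagseq_holds) (auto simp: o_def)
    then have "convergent (\<lambda>i. inner (x (d (i + Suc k))) (x k))" by (simp add: d_def add.commute)
    then show ?thesis
      unfolding W_def using convergent_ignore_initial_segment[of "\<lambda>i. inner (x (d i)) (x k)" "Suc k"] by simp
  qed
  have Wsub: "subspace W"
    by (auto simp: subspace_def W_def inner_add_right intro!: convergent_add convergent_mult convergent_const)
  have Wcl: "closed W"
  proof -
    have "z \<in> W" if z: "z \<in> closure W" for z
    proof -
      have "Cauchy (\<lambda>i. inner (x (d i)) z)"
      proof (rule metric_CauchyI)
        fix e :: real assume e: "0 < e"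
        define \<delta> where "\<delta> = e / (4 * (\<bar>K\<bar> + 1))"
        have \<delta>: "0 < \<delta>" "\<bar>K\<bar> * \<delta> \<le> e / 4" using e by (auto simp: \<delta>_def field_simps)
        obtain z' where z': "z' \<in> W" "dist z' z < \<delta>" using z \<delta> by (auto simp: closure_approachable)
        have "Cauchy (\<lambda>i. inner (x (d i)) z')" using z'(1) by (simp add: W_def Cauchy_convergent_iff)
        then obtain N where N: "\<And>i j. i \<ge> N \<Longrightarrow> j \<ge> N \<Longrightarrow> dist (inner (x (d i)) z') (inner (x (d j)) z') < e / 4"
          using e metric_CauchyD[of _ "e/4"] by (metis zero_less_divide_iff zero_less_numeral)
        have near: "\<bar>inner (x n) z - inner (x n) z'\<bar> \<le> e / 4" for n
        proof -
          have "\<bar>inner (x n) (z - z')\<bar> \<le> K * norm (z - z')" by (rule xK)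
          also have "\<dots> \<le> \<bar>K\<bar> * \<delta>"
            using z'(2) by (intro mult_mono) (auto simp: dist_norm norm_minus_commute)
          finally show ?thesis using \<delta> by (simp add: inner_diff_right)
        qed
        have "dist (inner (x (d i)) z) (inner (x (d j)) z) < e" if "i \<ge> N" "j \<ge> N" for i j
          using near[of "d i"] near[of "d j"] N[OF that] e unfolding dist_real_def by linarith
        then show "\<exists>N. \<forall>i\<ge>N. \<forall>j\<ge>N. dist (inner (x (d i)) z) (inner (x (d j)) z) < e" by blast
      qed
      then show ?thesis by (simp add: W_def Cauchy_convergent_iff)
    qed
    then show ?thesis unfolding closure_subset_eq[symmetric] by blast
  qed
  \<comment> \<open>Off \<open>W\<close> the value of \<open>lim\<close> is unspecified, so
    linearity and the bound are claimed on \<open>W\<close> only.\<close>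
  define \<phi> where "\<phi> z = lim (\<lambda>i. inner (x (d i)) z)" for z
  have \<phi>: "(\<lambda>i. inner (x (d i)) z) \<longlonglongrightarrow> \<phi> z" if "z \<in> W" for z
    using that by (simp add: W_def \<phi>_def convergent_LIMSEQ_iff)
  have \<phi>_eq: "\<phi> z = a" if "(\<lambda>i. inner (x (d i)) z) \<longlonglongrightarrow> a" for z a
    using that by (simp add: \<phi>_def limI)
  obtain l where l: "l \<in> W" "\<And>w. w \<in> W \<Longrightarrow> inner l w = \<phi> w"
  proof (rule lax_milgram_subspace[OF elliptic_id _ Wcl Wsub, of \<phi> K])
    show "\<phi> (u + v) = \<phi> u + \<phi> v" if "u \<in> W" "v \<in> W" for u v
      by (rule \<phi>_eq) (simp add: inner_add_right tendsto_add \<phi> that)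
    show "\<phi> (r *\<^sub>R u) = r * \<phi> u" if "u \<in> W" for r u
      by (rule \<phi>_eq) (simp add: tendsto_mult \<phi> that)
    show "\<bar>\<phi> u\<bar> \<le> K * norm u" if "u \<in> W" for u
      using xK by (intro LIMSEQ_le_const2[OF tendsto_rabs[OF \<phi>[OF that]]]) auto
  qed auto
  have "(\<lambda>i. inner (x (d i)) z) \<longlonglongrightarrow> inner l z" for z
  proof -
    \<comment> \<open>\<open>P\<close> is the orthogonal projection of \<open>z\<close> onto
      \<open>W\<close>; the sequence and \<open>l\<close> lie in \<open>W\<close>, so testing with
      \<open>z\<close> or with \<open>P\<close> gives the same values.\<close>
    obtain P where P: "P \<in> W" "\<And>w. w \<in> W \<Longrightarrow> inner P w = inner z w"
      using lax_milgram_subspace[OF elliptic_id _ Wcl Wsub, of "\<lambda>w. inner z w" "norm z"]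
      by (auto simp: inner_add_right Cauchy_Schwarz_ineq2)
    show ?thesis using \<phi>[OF P(1)] P(2)[OF xW] P(2)[OF l(1)] l(2)[OF P(1)]
      by (simp add: inner_commute)
  qed
  then have "weakly_converges (x \<circ> d) l" by (simp add: weakly_converges_def)
  then show ?thesis using that subseq_diagseq d_def by blast
qed

section \<open>Quasi-Fejer recursions for real sequences\<close>

lemma prod_one_plus_le_exp:
  fixes \<eta> :: "nat \<Rightarrow> real"
  assumes "\<And>n. 0 \<le> \<eta> n" "summable \<eta>" "finite I"
  shows "(\<Prod>k\<in>I. 1 + \<eta> k) \<le> exp (suminf \<eta>)"
proof -
  have "(\<Prod>k\<in>I. 1 + \<eta> k) \<le> (\<Prod>k\<in>I. exp (\<eta> k))"
    using assms by (intro prod_mono) auto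
  also have "\<dots> = exp (sum \<eta> I)" using assms by (simp add: exp_sum)
  also have "\<dots> \<le> exp (suminf \<eta>)" using assms by (simp add: sum_le_suminf)
  finally show ?thesis .
qed

lemma convergent_prod_one_plus:
  fixes \<eta> :: "nat \<Rightarrow> real"
  assumes "\<And>n. 0 \<le> \<eta> n" "summable \<eta>"
  shows "convergent (\<lambda>n. \<Prod>k<n. 1 + \<eta> k)" "1 \<le> (\<Prod>k<n. 1 + \<eta> k)"
proof -
  show ge1: "1 \<le> (\<Prod>k<n. 1 + \<eta> k)" for n using assms by (intro prod_ge_1) auto
  have "incseq (\<lambda>n. \<Prod>k<n. 1 + \<eta> k)"
  proof (rule incseq_SucI)
    fix n
    have "(\<Prod>k<n. 1 + \<eta> k) * 1 \<le> (\<Prod>k<n. 1 + \<eta> k) * (1 + \<eta> n)"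
      using assms ge1[of n] by (intro mult_left_mono) auto
    then show "(\<Prod>k<n. 1 + \<eta> k) \<le> (\<Prod>k<Suc n. 1 + \<eta> k)" by simp
  qed
  then show "convergent (\<lambda>n. \<Prod>k<n. 1 + \<eta> k)"
    by (rule incseq_convergent[of _ "exp (suminf \<eta>)"])
      (use prod_one_plus_le_exp[of \<eta>] assms in \<open>auto intro: convergentI\<close>)
qed

text \<open>The starting index is free and the factor does not depend on it: a quantity that is
  small at a late index, where little error remains to be added, stays small from there on.\<close>

lemma quasi_fejer_bound:
  fixes s e \<eta> :: "nat \<Rightarrow> real"
  assumes s: "\<And>n. 0 \<le> s n" and \<eta>: "\<And>n. 0 \<le> \<eta> n" "summable \<eta>" and e: "\<And>n. 0 \<le> e n"
    and step: "\<And>n. s (Suc n) \<le> (1 + \<eta> n) * s n + e n" and nm: "n \<le> m"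
  shows "s m \<le> exp (suminf \<eta>) * (s n + sum e {n..<m})"
proof -
  have "s m \<le> (\<Prod>k\<in>{n..<m}. 1 + \<eta> k) * (s n + sum e {n..<m})"
    using nm
  proof (induction m rule: dec_induct)
    case (step m)
    let ?P = "\<Prod>k\<in>{n..<m}. 1 + \<eta> k"
    have P1: "1 \<le> ?P * (1 + \<eta> m)"
      using \<eta> prod_ge_1[of "{n..<Suc m}" "\<lambda>k. 1 + \<eta> k"] step(1) by simp
    have "s (Suc m) \<le> (1 + \<eta> m) * (?P * (s n + sum e {n..<m})) + 1 * e m"
      using assms(5)[of m] mult_left_mono[OF step(3), of "1 + \<eta> m"] \<eta>(1)[of m] by linarith
    also have "\<dots> \<le> (1 + \<eta> m) * (?P * (s n + sum e {n..<m})) + (?P * (1 + \<eta> m)) * e m"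
      by (intro add_left_mono mult_right_mono P1 e)
    also have "\<dots> = (\<Prod>k\<in>{n..<Suc m}. 1 + \<eta> k) * (s n + sum e {n..<Suc m})"
      using step(1) by (simp add: algebra_simps)
    finally show ?case .
  qed simp
  also have "\<dots> \<le> exp (suminf \<eta>) * (s n + sum e {n..<m})"
    using s e by (intro mult_right_mono prod_one_plus_le_exp \<eta> add_nonneg_nonneg sum_nonneg) auto
  finally show ?thesis .
qed

text \<open>Division by the partial products, which lie between 1 and \<open>E\<close>, absorbs the
  factors 1 + \<eta>; subtracting the accumulated errors then leaves a decreasing sequence
  \<open>a\<close>, bounded below. Its total decrease bounds the sum of \<open>d\<close> up to the
  factor \<open>E\<close>.\<close>

lemma robbins_siegmund:
  fixes s d e \<eta> :: "nat \<Rightarrow> real"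
  assumes s: "\<And>n. 0 \<le> s n" and d: "\<And>n. 0 \<le> d n"
    and \<eta>: "\<And>n. 0 \<le> \<eta> n" "summable \<eta>" and e: "\<And>n. 0 \<le> e n" "summable e"
    and step: "\<And>n. s (Suc n) \<le> (1 + \<eta> n) * s n - d n + e n"
  shows "convergent s" "summable d"
proof -
  define P where "P n = (\<Prod>k<n. 1 + \<eta> k)" for n
  define E where "E = exp (suminf \<eta>)"
  have P1: "1 \<le> P n" and PE: "P n \<le> E" and PS: "P (Suc n) = P n * (1 + \<eta> n)" for n
    using convergent_prod_one_plus(2)[OF \<eta>] prod_one_plus_le_exp[OF \<eta>] by (simp_all add: P_def E_def)
  have E: "0 < E" by (simp add: E_def)
  define a where "a n = s n / P n - sum e {..<n}" for n
  have dec: "a (Suc n) + d n / E \<le> a n" for n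
  proof -
    have PSn: "1 \<le> P (Suc n)" by (rule P1)
    have "s (Suc n) / P (Suc n) \<le> ((1 + \<eta> n) * s n - d n + e n) / P (Suc n)"
      using PSn step[of n] by (intro divide_right_mono) auto
    also have "\<dots> = ((1 + \<eta> n) * s n) / (P n * (1 + \<eta> n)) - d n / P (Suc n) + e n / P (Suc n)"
      by (simp add: PS add_divide_distrib diff_divide_distrib)
    also have "((1 + \<eta> n) * s n) / (P n * (1 + \<eta> n)) = s n / P n"
      using \<eta>(1)[of n] by (intro nonzero_mult_divide_mult_cancel_left2) auto
    finally have 1: "s (Suc n) / P (Suc n) \<le> s n / P n - d n / P (Suc n) + e n / P (Suc n)" .
    have 2: "d n / E \<le> d n / P (Suc n)"
      using d[of n] PSn PE[of "Suc n"] by (intro divide_left_mono) auto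
    have "e n / P (Suc n) \<le> e n / 1"
      using e(1)[of n] PSn by (intro divide_left_mono) auto
    with 1 2 show ?thesis by (simp add: a_def)
  qed
  have low: "- suminf e \<le> a n" for n
  proof -
    have "sum e {..<n} \<le> suminf e" using e by (intro sum_le_suminf) auto
    moreover have "0 \<le> s n / P n" using s[of n] P1[of n] by simp
    ultimately show ?thesis by (simp add: a_def)
  qed
  have "decseq a"
    using dec d E by (intro decseq_SucI) (smt (verit) divide_nonneg_pos)
  then have "convergent a"
    by (rule decseq_convergent[of a "- suminf e"]) (use low in \<open>auto intro: convergentI\<close>)
  then have "convergent (\<lambda>n. P n * (a n + sum e {..<n}))"
    using convergent_prod_one_plus(1)[OF \<eta>] e(2)
    by (intro convergent_mult convergent_add) (simp_all add: P_def[abs_def] summable_iff_convergent)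
  moreover have "P n * (a n + sum e {..<n}) = s n" for n using P1[of n] by (simp add: a_def)
  ultimately show "convergent s" by simp
  have "sum d {..<n} \<le> E * (a 0 + suminf e)" for n
  proof -
    have "sum d {..<n} / E \<le> a 0 - a n"
    proof (induction n)
      case (Suc n)
      then show ?case using dec[of n] by (simp add: add_divide_distrib)
    qed simp
    with low[of n] have "sum d {..<n} / E \<le> a 0 + suminf e" by simp
    then show ?thesis using E by (simp add: field_simps)
  qed
  then show "summable d" using d by (intro summableI_nonneg_bounded)
qed

text \<open>Positivity is tested at w - D w / M. For a merely positive semidefinite \<open>D\<close>
  this is the tool that turns convergence of quadratic forms into convergence of vectors.\<close>

lemma elliptic_norm_square_le:
  assumes ell: "elliptic 0 M D" and M: "0 < M"
  shows "(norm (D w))\<^sup>2 \<le> M * inner (D w) w"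
proof -
  have "0 \<le> inner (D (w - (1/M) *\<^sub>R D w)) (w - (1/M) *\<^sub>R D w)"
    using elliptic_lower[OF ell, of "w - (1/M) *\<^sub>R D w"] by simp
  also have "\<dots> = inner (D w) w - 2 / M * (norm (D w))\<^sup>2 + (1/M)\<^sup>2 * inner (D (D w)) (D w)"
    unfolding elliptic_diff_square[OF ell] elliptic_scale_square[OF ell] by (simp add: power2_norm_eq_inner)
  also have "\<dots> \<le> inner (D w) w - 2 / M * (norm (D w))\<^sup>2 + (1/M)\<^sup>2 * (M * (norm (D w))\<^sup>2)"
    by (intro add_left_mono mult_left_mono elliptic_upper[OF ell]) auto
  also have "\<dots> = inner (D w) w - (norm (D w))\<^sup>2 / M"
    using M by (simp add: power2_eq_square field_simps)
  finally show ?thesis using M by (simp add: field_simps)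
qed

text \<open>After division by the partial products of 1 + \<eta> the operators decrease in the
  Loewner order. Their quadratic forms then converge, differences of them are positive semidefinite
  and bounded by \<open>2 * M\<close>, and \<open>elliptic_norm_square_le\<close> makes the vectors
  Cauchy. Multiplying back is harmless since the products converge.\<close>

lemma elliptic_strong_limit:
  fixes V :: "nat \<Rightarrow> 'a::{real_inner,complete_space} \<Rightarrow> 'a"
  assumes ell: "\<And>n. elliptic m M (V n)" and m: "0 < m" and M: "0 < M"
    and \<eta>: "\<And>n. 0 \<le> \<eta> n" "summable \<eta>"
    and dec: "\<And>n x. inner (V (Suc n) x) x \<le> (1 + \<eta> n) * inner (V n x) x"
  obtains W where "elliptic m M W" "\<And>x. (\<lambda>n. V n x) \<longlonglongrightarrow> W x"
proof -
  define P where "P n = (\<Prod>k<n. 1 + \<eta> k)" for n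
  have P1: "1 \<le> P n" and PS: "P (Suc n) = P n * (1 + \<eta> n)" for n
    using convergent_prod_one_plus(2)[OF \<eta>] by (simp_all add: P_def)
  define T where "T n x = (1 / P n) *\<^sub>R V n x" for n x
  have V0: "0 \<le> inner (V n x) x" for n x
    using elliptic_lower[OF ell, of x n] m by (smt (verit) mult_nonneg_nonneg zero_le_power2)
  have T0: "0 \<le> inner (T n x) x" for n x using V0[of n x] P1[of n] by (simp add: T_def)
  have Tdec: "decseq (\<lambda>n. inner (T n x) x)" for x
  proof (rule decseq_SucI)
    fix n
    have "inner (V (Suc n) x) x / P (Suc n) \<le> (1 + \<eta> n) * inner (V n x) x / P (Suc n)"
      using dec[of n x] P1[of "Suc n"] by (intro divide_right_mono) auto
    also have "\<dots> = inner (V n x) x / P n" unfolding PS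
      using \<eta>(1)[of n] by (intro nonzero_mult_divide_mult_cancel_left2) auto
    finally show "inner (T (Suc n) x) x \<le> inner (T n x) x" by (simp add: T_def)
  qed
  have Tn: "norm (T n x) \<le> M * norm x" for n x
  proof -
    have "norm (T n x) = norm (V n x) / P n" using P1[of n] by (simp add: T_def)
    also have "\<dots> \<le> norm (V n x) / 1" using P1[of n] by (intro divide_left_mono) auto
    also have "\<dots> \<le> M * norm x" using elliptic_norm[OF ell] by simp
    finally show ?thesis .
  qed
  have ellD: "elliptic 0 (2 * M) (\<lambda>x. T i x - T j x)" if "i \<le> j" for i j
    unfolding elliptic_def
  proof (intro conjI allI)
    show "linear (\<lambda>x. T i x - T j x)"
      by (rule linearI) (simp_all add: T_def elliptic_simps[OF ell] algebra_simps)
    fix x y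
    show "inner (T i x - T j x) y = inner x (T i y - T j y)"
      by (simp add: T_def inner_diff_left inner_diff_right elliptic_sym[OF ell])
    show "0 * (norm x)\<^sup>2 \<le> inner (T i x - T j x) x"
      using decseqD[OF Tdec that, of x] by (simp add: inner_diff_left)
    show "norm (T i x - T j x) \<le> 2 * M * norm x"
      using norm_triangle_ineq4[of "T i x" "T j x"] Tn[of i x] Tn[of j x] by simp
  qed
  have "convergent (\<lambda>n. T n x)" for x
  proof -
    have "convergent (\<lambda>n. inner (T n x) x)"
      by (rule decseq_convergent[OF Tdec, of 0 x]) (use T0 in \<open>auto intro: convergentI\<close>)
    then have C: "Cauchy (\<lambda>n. inner (T n x) x)" by (simp add: Cauchy_convergent_iff)
    have "Cauchy (\<lambda>n. T n x)"
    proof (rule CauchyI')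
      fix e :: real assume e: "0 < e"
      then obtain N where N: "\<And>i j. i \<ge> N \<Longrightarrow> j \<ge> N \<Longrightarrow> dist (inner (T i x) x) (inner (T j x) x) < e\<^sup>2 / (2 * M)"
        using metric_CauchyD[OF C, of "e\<^sup>2 / (2 * M)"] M by auto
      have "dist (T i x) (T j x) < e" if "i \<ge> N" "j > i" for i j
      proof -
        have "(norm (T i x - T j x))\<^sup>2 \<le> 2 * M * inner (T i x - T j x) x"
          using elliptic_norm_square_le[OF ellD[of i j]] that M by simp
        also have "inner (T i x - T j x) x < e\<^sup>2 / (2 * M)"
          using N[of i j] that by (simp add: inner_diff_left dist_real_def)
        finally have "(norm (T i x - T j x))\<^sup>2 < e\<^sup>2" using M by simp
        then show ?thesis using e by (simp add: dist_norm power2_less_imp_less)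
      qed
      then show "\<exists>N. \<forall>i\<ge>N. \<forall>j>i. dist (T i x) (T j x) < e" by blast
    qed
    then show ?thesis by (simp add: Cauchy_convergent_iff)
  qed
  moreover have "convergent P"
    using convergent_prod_one_plus(1)[OF \<eta>] by (simp add: P_def[abs_def])
  ultimately have "convergent (\<lambda>n. P n *\<^sub>R T n x)" for x
    using tendsto_scaleR by (fastforce simp: convergent_def)
  moreover have "P n *\<^sub>R T n x = V n x" for n x using P1[of n] by (simp add: T_def)
  ultimately have "\<exists>l. (\<lambda>n. V n x) \<longlonglongrightarrow> l" for x by (simp add: convergent_def)
  then obtain W where W: "\<And>x. (\<lambda>n. V n x) \<longlonglongrightarrow> W x" by metis
  have "elliptic m M W" unfolding elliptic_def
  proof (intro conjI allI)
    show "linear W"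
    proof (rule linearI)
      fix x y r
      have "(\<lambda>n. V n x + V n y) \<longlonglongrightarrow> W x + W y" by (intro tendsto_intros W)
      then show "W (x + y) = W x + W y"
        using LIMSEQ_unique[OF W[of "x + y"]] by (simp add: elliptic_simps[OF ell])
      have "(\<lambda>n. r *\<^sub>R V n x) \<longlonglongrightarrow> r *\<^sub>R W x" by (intro tendsto_intros W)
      then show "W (r *\<^sub>R x) = r *\<^sub>R W x"
        using LIMSEQ_unique[OF W[of "r *\<^sub>R x"]] by (simp add: elliptic_simps[OF ell])
    qed
    fix x y
    have "(\<lambda>n. inner (V n x) y) \<longlonglongrightarrow> inner (W x) y" by (intro tendsto_intros W)
    moreover have "(\<lambda>n. inner x (V n y)) \<longlonglongrightarrow> inner x (W y)" by (intro tendsto_intros W)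
    ultimately show "inner (W x) y = inner x (W y)"
      using LIMSEQ_unique by (simp add: elliptic_sym[OF ell])
    have "(\<lambda>n. inner (V n x) x) \<longlonglongrightarrow> inner (W x) x" by (intro tendsto_intros W)
    then show "m * (norm x)\<^sup>2 \<le> inner (W x) x"
      by (rule LIMSEQ_le_const) (use elliptic_lower[OF ell] in auto)
    show "norm (W x) \<le> M * norm x"
      by (rule LIMSEQ_le_const2[OF tendsto_norm[OF W]]) (use elliptic_norm[OF ell] in auto)
  qed
  with W show ?thesis using that by blast
qed

text \<open>Opial's argument: the difference of two convergent squared distances isolates \<open>\<langle>x\<^sub>n, V\<^sub>n (z - z')\<rangle>\<close>.\<close>

lemma opial_variable_metric:
  fixes x :: "nat \<Rightarrow> 'a::{real_inner,complete_space}"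
  assumes ell: "\<And>n. elliptic m M (V n)" and ellW: "elliptic m M W" and m: "0 < m"
    and VW: "\<And>z. (\<lambda>n. V n z) \<longlonglongrightarrow> W z" and bdd: "\<And>n. norm (x n) \<le> K"
    and conv: "\<And>z. z \<in> Z \<Longrightarrow> convergent (\<lambda>n. inner (V n (x n - z)) (x n - z))"
    and cluster: "\<And>r z. strict_mono r \<Longrightarrow> weakly_converges (x \<circ> r) z \<Longrightarrow> z \<in> Z"
  shows "\<exists>z\<in>Z. weakly_converges x z"
proof -
  have uniq: "z = z'" if r: "strict_mono r" "weakly_converges (x \<circ> r) z"
    and r': "strict_mono r'" "weakly_converges (x \<circ> r') z'" for r r' z z'
  proof -
    note Z = cluster[OF r] cluster[OF r']
    let ?f = "\<lambda>n. inner (x n) (V n (z - z'))"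
    have sq: "inner (V n (x n - w)) (x n - w) = inner (V n (x n)) (x n) - 2 * inner (V n (x n)) w + inner (V n w) w"
      for n w by (rule elliptic_diff_square[OF ell])
    have eq: "?f n = 1 / 2 * (inner (V n (x n - z')) (x n - z') - inner (V n (x n - z)) (x n - z)
        + inner (V n z) z - inner (V n z') z')" for n
      using elliptic_sym[OF ell, of n "x n" z] elliptic_sym[OF ell, of n "x n" z']
      unfolding sq by (simp add: elliptic_simps[OF ell] inner_diff_right)
    have "convergent (\<lambda>n. inner (V n z) z)" for z
      using tendsto_inner[OF VW tendsto_const] by (auto simp: convergent_def)
    then have "convergent ?f"
      unfolding eq using conv[OF Z(1)] conv[OF Z(2)]
      by (intro convergent_mult convergent_add convergent_diff convergent_const) auto
    then obtain L where L: "?f \<longlonglongrightarrow> L" by (auto simp: convergent_def)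
    \<comment> \<open>Strong convergence of \<open>V n\<close> at the fixed vector
      \<open>z - z'\<close> lets the weak limit pass. Both cluster points give the same number
      \<open>L\<close>, so the \<open>W\<close>-square of their difference is 0.\<close>
    have lim: "inner w (W (z - z')) = L" if s: "strict_mono s" "weakly_converges (x \<circ> s) w" for s w
    proof -
      have "(\<lambda>n. V (s n) (z - z')) \<longlonglongrightarrow> W (z - z')"
        using LIMSEQ_subseq_LIMSEQ[OF VW s(1), of "z - z'"] by (simp add: o_def)
      with s(2) bdd have "(\<lambda>n. inner ((x \<circ> s) n) (V (s n) (z - z'))) \<longlonglongrightarrow> inner w (W (z - z'))"
        by (intro tendsto_inner_weak_strong[of "x \<circ> s" _ K]) auto
      moreover have "(\<lambda>n. inner ((x \<circ> s) n) (V (s n) (z - z'))) \<longlonglongrightarrow> L"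
        using LIMSEQ_subseq_LIMSEQ[OF L s(1)] by (simp add: o_def)
      ultimately show ?thesis by (rule LIMSEQ_unique)
    qed
    have "inner (W (z - z')) (z - z') = 0"
      using lim[OF r] lim[OF r'] by (simp add: inner_diff_left inner_commute[of "W _"])
    then show "z = z'" using elliptic_lower[OF ellW, of "z - z'"] m by (simp add: mult_le_0_iff)
  qed
  obtain r l where r: "strict_mono r" "weakly_converges (x \<circ> r) l"
    by (rule bounded_weakly_convergent_subsequence[OF bdd])
  have "weakly_converges x l"
    unfolding weakly_converges_def
  proof (intro allI, rule ccontr)
    fix w assume "\<not> (\<lambda>n. inner (x n) w) \<longlonglongrightarrow> inner l w"
    then obtain e where e: "0 < e" "\<exists>\<^sub>F n in sequentially. e \<le> dist (inner (x n) w) (inner l w)"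
      unfolding tendsto_iff by (auto simp: not_eventually not_less)
    then have inf: "infinite {n. e \<le> dist (inner (x n) w) (inner l w)}"
      by (simp add: frequently_cofinite cofinite_eq_sequentially[symmetric])
    \<comment> \<open>If weak convergence failed at \<open>w\<close>, these infinitely many indices
      would stay \<open>e\<close> away; a weakly convergent subsequence of them has limit
      \<open>l\<close> by \<open>uniq\<close>, a contradiction.\<close>
    define s where "s = enumerate {n. e \<le> dist (inner (x n) w) (inner l w)}"
    have s: "strict_mono s" unfolding s_def by (rule strict_mono_enumerate[OF inf])
    have se: "e \<le> dist (inner (x (s n)) w) (inner l w)" for n
      using enumerate_in_set[OF inf, of n] by (simp add: s_def)
    obtain r' l' where r': "strict_mono r'" "weakly_converges ((x \<circ> s) \<circ> r') l'"
      by (rule bounded_weakly_convergent_subsequence[of "x \<circ> s" K]) (use bdd in auto)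
    have "weakly_converges (x \<circ> (s \<circ> r')) l'" using r'(2) by (simp add: o_assoc)
    then have "l' = l" using uniq[OF strict_mono_o[OF s r'(1)] _ r] by blast
    then have "(\<lambda>n. dist (inner (x (s (r' n))) w) (inner l w)) \<longlonglongrightarrow> dist (inner l w) (inner l w)"
      using r'(2) by (intro tendsto_dist tendsto_const) (simp add: weakly_converges_def)
    from LIMSEQ_le_const[OF this, of e] se e(1) show False by auto
  qed
  with cluster[OF r] show ?thesis by blast
qed

section \<open>One step of the algorithm and criteria for strong convergence\<close>

text \<open>Young's inequality with weight \<open>e\<close>: the cross term is charged to
  \<open>a\<close> with factor \<open>e\<close>, and the remainder does not involve
  \<open>a\<close>. With \<open>a\<close> a difference to a zero, the additive error is thus the
  same for all zeros.\<close>

lemma elliptic_perturb: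
  assumes ell: "elliptic m M V" and m: "0 \<le> m" and M: "0 \<le> M"
    and e: "0 \<le> e" and C: "0 \<le> C" and r: "norm r \<le> C * e"
  shows "inner (V (a + r)) (a + r) \<le> (1 + e) * inner (V a) a + M * C\<^sup>2 * (e + e\<^sup>2)"
proof -
  \<comment> \<open>This separates the small factor \<open>e\<close> from a vector bounded by
    \<open>C\<close>; for \<open>e = 0\<close> the hypothesis forces \<open>r = 0\<close>.\<close>
  obtain s where s: "r = e *\<^sub>R s" "norm s \<le> C"
  proof (cases "e = 0")
    case True
    then show ?thesis using that[of 0] r C by simp
  next
    case False
    then show ?thesis using that[of "(1/e) *\<^sub>R r"] r e by (simp add: field_simps)
  qed
  have "(norm s)\<^sup>2 \<le> C\<^sup>2" using s(2) by (intro power_mono) auto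
  then have Vs: "inner (V s) s \<le> M * C\<^sup>2"
    using elliptic_upper[OF ell, of s] mult_left_mono[of "(norm s)\<^sup>2" "C\<^sup>2" M] M by linarith
  have "0 \<le> inner (V (a - s)) (a - s)"
    using elliptic_lower[OF ell, of "a - s"] m by (smt (verit) mult_nonneg_nonneg zero_le_power2)
  then have "2 * inner (V a) s \<le> inner (V a) a + inner (V s) s"
    unfolding elliptic_diff_square[OF ell] by simp
  then have "e * (2 * inner (V a) s) \<le> e * (inner (V a) a + inner (V s) s)"
    using e by (rule mult_left_mono)
  moreover have "(e + e\<^sup>2) * inner (V s) s \<le> (e + e\<^sup>2) * (M * C\<^sup>2)"
    using e Vs by (intro mult_left_mono) auto
  moreover have "inner (V (a + r)) (a + r)
      = inner (V a) a + e * (2 * inner (V a) s) + e\<^sup>2 * inner (V s) s"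
    unfolding s(1) elliptic_add_square[OF ell] elliptic_scale_square[OF ell] by simp
  ultimately show ?thesis by (simp add: algebra_simps)
qed

text \<open>With w = x - p and D = x - x', expanding squares in the metric \<open>V\<close> replaces
  the square of \<open>x - z\<close> by itself minus that of \<open>w\<close> plus that of
  \<open>D - w\<close>, up to the term in \<open>inner (p - z) v\<close>. Here \<open>D - w\<close>
  is the forward correction, whose square is at most \<open>(1 - \<epsilon>)\<^sup>2\<close> times
  \<open>(norm w)\<^sup>2 / \<mu>\<close>: the bound \<mu> on \<open>L\<close> and the bound 1 /
  \<mu> on \<open>V\<close> match. The term in \<open>v\<close> is kept, its sign being a matter of
  monotonicity.\<close>

lemma fbf_step:
  assumes L: "elliptic \<alpha> \<mu> L" and V: "elliptic (1 / \<mu>) (1 / \<alpha>) V"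
    and LV: "\<And>x. L (V x) = x" and VL: "\<And>x. V (L x) = x"
    and pos: "0 < \<mu>" "0 < \<beta>" "0 < \<gamma>" and \<gamma>: "\<gamma> * \<beta> * \<mu> \<le> 1 - \<epsilon>"
    and Bl: "\<And>x y. norm (B x - B y) \<le> \<beta> * norm (x - y)"
    and v: "v = (1/\<gamma>) *\<^sub>R V (x - \<gamma> *\<^sub>R L (B x) - p) + B p"
    and x': "x' = p + \<gamma> *\<^sub>R L (B x - B p)"
  shows "inner (V (x' - z)) (x' - z)
      \<le> inner (V (x - z)) (x - z) - (1 - (1 - \<epsilon>)\<^sup>2) / \<mu> * (norm (x - p))\<^sup>2 - 2 * \<gamma> * inner (p - z) v"
    and "V (x - x') = \<gamma> *\<^sub>R v"
proof -
  show Vd: "V (x - x') = \<gamma> *\<^sub>R v"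
    using pos by (simp add: v x' elliptic_simps[OF V] elliptic_simps[OF L] VL algebra_simps)
  define w where "w = x - p"
  define D where "D = x - x'"
  define b where "b = B x - B p"
  have sym: "inner (V D) a = \<gamma> * inner a v" for a
    by (simp add: D_def Vd inner_commute)
  have Dw: "D - w = - (\<gamma> *\<^sub>R L b)" by (simp add: D_def w_def x' b_def)
  have "inner (V (D - w)) (D - w) = \<gamma>\<^sup>2 * inner (L b) b"
    unfolding Dw by (simp add: elliptic_simps[OF V] VL linear_neg[OF elliptic_linear[OF V]]
      inner_commute power2_eq_square)
  also have "\<dots> \<le> \<gamma>\<^sup>2 * (\<mu> * (norm b)\<^sup>2)"
    by (intro mult_left_mono elliptic_upper[OF L]) auto
  also have "\<dots> \<le> \<gamma>\<^sup>2 * (\<mu> * (\<beta> * norm w)\<^sup>2)"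
    using pos Bl[of x p] by (intro mult_left_mono power_mono) (auto simp: b_def w_def)
  also have "\<dots> = (\<gamma> * \<beta> * \<mu>)\<^sup>2 * ((norm w)\<^sup>2 / \<mu>)"
    using pos by (simp add: power2_eq_square)
  also have "\<dots> \<le> (1 - \<epsilon>)\<^sup>2 * ((norm w)\<^sup>2 / \<mu>)"
    using pos \<gamma> by (intro mult_right_mono power_mono) auto
  finally have h: "inner (V (D - w)) (D - w) \<le> (1 - \<epsilon>)\<^sup>2 * ((norm w)\<^sup>2 / \<mu>)" .
  have wV: "(norm w)\<^sup>2 / \<mu> \<le> inner (V w) w" using elliptic_lower[OF V, of w] by simp
  have "x' - z = (x - z) - D" by (simp add: D_def)
  then have "inner (V (x' - z)) (x' - z) = inner (V (x - z)) (x - z) - 2 * inner (V D) (x - z) + inner (V D) D"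
    by (simp only: elliptic_diff_square[OF V]) (simp add: elliptic_sym[OF V] inner_commute)
  moreover have "inner (V (D - w)) (D - w) = inner (V D) D - 2 * inner (V D) w + inner (V w) w"
    by (rule elliptic_diff_square[OF V])
  moreover have "inner (V D) (x - z) = inner (V D) w + \<gamma> * inner (p - z) v"
    unfolding sym by (simp add: w_def inner_diff_left algebra_simps)
  ultimately have "inner (V (x' - z)) (x' - z)
      \<le> inner (V (x - z)) (x - z) - (norm w)\<^sup>2 / \<mu> + (1 - \<epsilon>)\<^sup>2 * ((norm w)\<^sup>2 / \<mu>) - 2 * \<gamma> * inner (p - z) v"
    using h wV by linarith
  then show "inner (V (x' - z)) (x' - z)
      \<le> inner (V (x - z)) (x - z) - (1 - (1 - \<epsilon>)\<^sup>2) / \<mu> * (norm (x - p))\<^sup>2 - 2 * \<gamma> * inner (p - z) v"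
    by (simp add: w_def left_diff_distrib diff_divide_distrib)
qed

text \<open>Monotonicity of \<open>A\<close> and the bounds on \<open>V\<close> make the resolvent
  Lipschitz with constant \<mu> / \<alpha> in norm, while \<gamma> \<open>L\<close> has norm at most
  1 / \<beta>. Hence p - p' is bounded by \<mu> / (\<alpha> \<beta>) times the norm of
  \<open>a\<close> plus that of \<open>b\<close>. In the update, p - p' appears once directly and
  once through \<open>B\<close>, which explains the 2 in \<open>C\<close>; the summand 1 / \<beta>
  pays for \<open>a\<close> and \<open>c\<close>.\<close>

lemma fbf_error:
  assumes L: "elliptic \<alpha> \<mu> L" and V: "elliptic (1 / \<mu>) (1 / \<alpha>) V"
    and pos: "0 < \<mu>" "0 < \<beta>" "0 < \<gamma>" "0 < \<alpha>" and \<gamma>: "\<gamma> * \<beta> * \<mu> \<le> 1"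
    and Bl: "\<And>x y. norm (B x - B y) \<le> \<beta> * norm (x - y)"
    and A: "monotone_op A"
    and p': "(1/\<gamma>) *\<^sub>R V (y' - p') \<in> A p'" and y': "y' = x - \<gamma> *\<^sub>R L (B x)"
    and p0: "(1/\<gamma>) *\<^sub>R V (y - p0) \<in> A p0" and y: "y = x - \<gamma> *\<^sub>R L (B x + a)"
    and p: "p = p0 + b" and q: "q = p - \<gamma> *\<^sub>R L (B p + c)"
    and C: "C = 2 * (\<mu> / (\<alpha> * \<beta>) + 1) + 1 / \<beta>"
  shows "norm (p - p') \<le> C * (norm a + norm b + norm c)"
    and "norm ((x - y + q) - (p' + \<gamma> *\<^sub>R L (B x - B p'))) \<le> C * (norm a + norm b + norm c)"
    and "norm (\<gamma> *\<^sub>R L w) \<le> norm w / \<beta>"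
proof -
  show gL: "norm (\<gamma> *\<^sub>R L w) \<le> norm w / \<beta>" for w
  proof -
    have "\<gamma> * norm (L w) \<le> \<gamma> * (\<mu> * norm w)"
      using pos by (intro mult_left_mono elliptic_norm[OF L]) auto
    also have "\<dots> = (\<gamma> * \<beta> * \<mu>) * (norm w / \<beta>)" using pos by simp
    also have "\<dots> \<le> 1 * (norm w / \<beta>)" using pos \<gamma> by (intro mult_right_mono) auto
    finally show ?thesis using pos by simp
  qed
  have "0 \<le> inner (p0 - p') ((1/\<gamma>) *\<^sub>R V (y - p0) - (1/\<gamma>) *\<^sub>R V (y' - p'))"
    using A p' p0 by (simp add: monotone_op_def)
  also have "\<dots> = (1/\<gamma>) * (inner (p0 - p') (V (y - y')) - inner (V (p0 - p')) (p0 - p'))"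
    by (simp add: elliptic_simps[OF V] inner_diff_right inner_diff_left algebra_simps inner_commute)
  finally have "inner (V (p0 - p')) (p0 - p') \<le> inner (p0 - p') (V (y - y'))"
    using pos by (simp add: zero_le_divide_iff)
  also have "\<dots> \<le> norm (p0 - p') * norm (V (y - y'))" by (rule norm_cauchy_schwarz)
  also have "\<dots> \<le> norm (p0 - p') * (1 / \<alpha> * norm (y - y'))"
    by (intro mult_left_mono elliptic_norm[OF V]) auto
  finally have "(1 / \<mu>) * (norm (p0 - p'))\<^sup>2 \<le> norm (p0 - p') * (1 / \<alpha> * norm (y - y'))"
    using elliptic_lower[OF V, of "p0 - p'"] by linarith
  then have "norm (p0 - p') * norm (p0 - p') \<le> norm (p0 - p') * (\<mu> / \<alpha> * norm (y - y'))"
    using pos by (simp add: power2_eq_square field_simps)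
  then have py: "norm (p0 - p') \<le> \<mu> / \<alpha> * norm (y - y')"
    using pos by (cases "p0 = p'") (auto simp: mult_le_cancel_left_pos simp del: times_divide_eq_left)
  have "norm (y - y') \<le> norm a / \<beta>"
    using gL[of a] by (simp add: y y' elliptic_simps[OF L] algebra_simps)
  from mult_left_mono[OF this, of "\<mu> / \<alpha>"] py pos
  have "norm (p0 - p') \<le> \<mu> / \<alpha> * (norm a / \<beta>)" by auto
  then have pp: "norm (p - p') \<le> \<mu> / (\<alpha> * \<beta>) * norm a + norm b"
    using norm_triangle_ineq[of "p0 - p'" b] by (simp add: p algebra_simps)
  have \<mu>': "0 \<le> \<mu> / (\<alpha> * \<beta>)" using pos by simp
  have "2 * P + (u + w) * j \<le> (2 * (k + 1) + j) * (u + v + w)"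
    if "P \<le> k * u + v" "0 \<le> k" "0 \<le> j" "0 \<le> u" "0 \<le> v" "0 \<le> w" for P k j u v w :: real
  proof -
    have 1: "2 * P \<le> 2 * (k * u + v)"
      and 2: "0 \<le> 2 * (k * v) + 2 * (k * w) + 2 * u + 2 * w + j * v"
      using that by simp_all
    have 3: "(2 * (k + 1) + j) * (u + v + w)
        = 2 * (k * u + v) + (u + w) * j + (2 * (k * v) + 2 * (k * w) + 2 * u + 2 * w + j * v)"
      by (simp add: algebra_simps)
    show ?thesis
      unfolding 3 using add_mono[OF add_mono[OF 1 order_refl] 2, of "(u + w) * j"] by (simp only: add_0_right)
  qed
  from this[OF pp \<mu>', of "1 / \<beta>" "norm c"] pos
  have pp2: "2 * norm (p - p') + (norm a + norm c) / \<beta> \<le> C * (norm a + norm b + norm c)"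
    by (simp add: C)
  have "0 \<le> (norm a + norm c) / \<beta>" using pos by simp
  with pp2 show "norm (p - p') \<le> C * (norm a + norm b + norm c)"
    using norm_ge_zero[of "p - p'"] by linarith
  have eq: "(x - y + q) - (p' + \<gamma> *\<^sub>R L (B x - B p')) = (p - p') + \<gamma> *\<^sub>R L (a - (B p - B p') - c)"
    by (simp add: y q elliptic_simps[OF L] algebra_simps)
  have "norm ((x - y + q) - (p' + \<gamma> *\<^sub>R L (B x - B p')))
     \<le> norm (p - p') + norm (a - (B p - B p') - c) / \<beta>"
    using norm_triangle_ineq[of "p - p'" "\<gamma> *\<^sub>R L (a - (B p - B p') - c)"] gL[of "a - (B p - B p') - c"]
    unfolding eq by linarith
  also have "norm (a - (B p - B p') - c) \<le> norm a + \<beta> * norm (p - p') + norm c"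
    using norm_triangle_ineq4[of "a - (B p - B p')" c] norm_triangle_ineq4[of a "B p - B p'"] Bl[of p p']
    by linarith
  finally have "norm ((x - y + q) - (p' + \<gamma> *\<^sub>R L (B x - B p')))
     \<le> norm (p - p') + (norm a + \<beta> * norm (p - p') + norm c) / \<beta>"
    using pos by (simp add: divide_right_mono)
  also have "\<dots> = 2 * norm (p - p') + (norm a + norm c) / \<beta>"
    using pos by (simp add: add_divide_distrib)
  finally show "norm ((x - y + q) - (p' + \<gamma> *\<^sub>R L (B x - B p'))) \<le> C * (norm a + norm b + norm c)"
    using pp2 by linarith
qed

text \<open>At an index where the iterate is close to some zero and the error tail is small, all
  later iterates are trapped near that zero, so the sequence is Cauchy. Its strong limit must be the
  weak one.\<close>

lemma quasi_fejer_strong_if_infdist: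
  fixes x :: "nat \<Rightarrow> 'a::{real_inner,complete_space}"
  assumes ell: "\<And>n. elliptic m M (V n)" and m: "0 < m" and M: "0 < M"
    and \<eta>: "\<And>n. 0 \<le> \<eta> n" "summable \<eta>" and e: "\<And>n. 0 \<le> e n" "summable e"
    and step: "\<And>z n. z \<in> Z \<Longrightarrow> inner (V (Suc n) (x (Suc n) - z)) (x (Suc n) - z)
       \<le> (1 + \<eta> n) * inner (V n (x n - z)) (x n - z) + e n"
    and Z: "Z \<noteq> {}" and weak: "weakly_converges x l"
    and lim: "liminf (\<lambda>n. ereal (infdist (x n) Z)) = 0"
  shows "x \<longlonglongrightarrow> l"
proof -
  define E where "E = exp (suminf \<eta>)"
  have E: "0 < E" by (simp add: E_def)
  have V0: "0 \<le> inner (V n w) w" for n w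
    using elliptic_lower[OF ell, of w n] m by (smt (verit) mult_nonneg_nonneg zero_le_power2)
  \<comment> \<open>Chosen so that a distance below \<delta> and an error tail below
    \<open>\<delta>\<^sup>2\<close> at index n give distances below \<open>C * \<delta>\<close>
    afterwards: M and 1 come from these two contributions, E from \<open>quasi_fejer_bound\<close>,
    and m from the lower bound of the metric.\<close>
  define C where "C = sqrt (E * (M + 1) / m)"
  have C: "0 < C" "C\<^sup>2 = E * (M + 1) / m" using E M m by (simp_all add: C_def)
  have "Cauchy x"
  proof (rule metric_CauchyI)
    fix \<epsilon> :: real assume eps: "0 < \<epsilon>"
    define \<delta> where "\<delta> = \<epsilon> / (2 * C)"
    have \<delta>: "0 < \<delta>" using eps C by (simp add: \<delta>_def)
    have "eventually (\<lambda>n. norm (\<Sum>k. e (k + n)) < \<delta>\<^sup>2) sequentially"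
      using suminf_exist_split[OF _ e(2), of "\<delta>\<^sup>2"] \<delta> by (auto simp: eventually_sequentially)
    \<comment> \<open>The lower limit gives small distances only infinitely often; one such index
      beyond the point where the error tail is small suffices.\<close>
    moreover have "\<exists>\<^sub>F n in sequentially. infdist (x n) Z < \<delta>"
    proof (rule ccontr)
      assume "\<not> (\<exists>\<^sub>F n in sequentially. infdist (x n) Z < \<delta>)"
      then have "\<forall>\<^sub>F n in sequentially. ereal \<delta> \<le> ereal (infdist (x n) Z)"
        by (simp add: not_frequently not_less)
      then have "ereal \<delta> \<le> 0" using Liminf_bounded lim by metis
      with \<delta> show False by simp
    qed
    ultimately obtain n where n: "infdist (x n) Z < \<delta>" "norm (\<Sum>k. e (k + n)) < \<delta>\<^sup>2"
      using frequently_eventually_frequently frequently_ex by (metis (mono_tags, lifting))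
    obtain z where z: "z \<in> Z" "dist (x n) z < \<delta>"
      using n(1) Z cInf_lessD[of "dist (x n) ` Z" \<delta>] by (auto simp: infdist_def)
    have near: "dist (x k) z < C * \<delta>" if k: "n \<le> k" for k
    proof -
      have "sum e {n..<k} = (\<Sum>i<k - n. e (i + n))"
        using k by (intro sum.reindex_bij_witness[of _ "\<lambda>i. i + n" "\<lambda>i. i - n"]) auto
      also have "\<dots> \<le> (\<Sum>i. e (i + n))"
        using e by (intro sum_le_suminf) (auto simp: summable_iff_shift)
      also have "\<dots> < \<delta>\<^sup>2" using n(2) by simp
      finally have tail: "sum e {n..<k} < \<delta>\<^sup>2" .
      have "inner (V n (x n - z)) (x n - z) \<le> M * (norm (x n - z))\<^sup>2" by (rule elliptic_upper[OF ell])
      also have "\<dots> \<le> M * \<delta>\<^sup>2"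
        using z M by (intro mult_left_mono power_mono) (auto simp: dist_norm)
      finally have "inner (V n (x n - z)) (x n - z) + sum e {n..<k} < (M + 1) * \<delta>\<^sup>2"
        using tail by (simp add: distrib_right)
      then have "E * (inner (V n (x n - z)) (x n - z) + sum e {n..<k}) < E * ((M + 1) * \<delta>\<^sup>2)"
        using E by simp
      moreover have "inner (V k (x k - z)) (x k - z) \<le> E * (inner (V n (x n - z)) (x n - z) + sum e {n..<k})"
        unfolding E_def
        by (rule quasi_fejer_bound[where s="\<lambda>n. inner (V n (x n - z)) (x n - z)"])
          (use V0 \<eta> e step z k in auto)
      moreover have "m * (norm (x k - z))\<^sup>2 \<le> inner (V k (x k - z)) (x k - z)" by (rule elliptic_lower[OF ell])
      ultimately have "m * (norm (x k - z))\<^sup>2 < E * ((M + 1) * \<delta>\<^sup>2)" by linarith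
      then have "(norm (x k - z))\<^sup>2 < (C * \<delta>)\<^sup>2"
        using m by (simp add: power_mult_distrib C(2) field_simps)
      then show ?thesis using C \<delta> by (simp add: dist_norm power2_less_imp_less)
    qed
    have "dist (x i) (x j) < \<epsilon>" if "i \<ge> n" "j \<ge> n" for i j
    proof -
      have "dist (x i) (x j) < C * \<delta> + C * \<delta>"
        using dist_triangle2[of "x i" "x j" z] near[OF that(1)] near[OF that(2)] by linarith
      also have "\<dots> = \<epsilon>" using C by (simp add: \<delta>_def)
      finally show ?thesis .
    qed
    then show "\<exists>N. \<forall>i\<ge>N. \<forall>j\<ge>N. dist (x i) (x j) < \<epsilon>" by blast
  qed
  then obtain l' where l': "x \<longlonglongrightarrow> l'" by (auto simp: Cauchy_convergent_iff convergent_def)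
  then show ?thesis using weakly_converges_unique[OF weak tendsto_weakly_converges] by blast
qed

lemma Cauchy_if_summable_dist:
  fixes g :: "nat \<Rightarrow> 'a::metric_space"
  assumes "summable (\<lambda>n. dist (g (Suc n)) (g n))"
  shows "Cauchy g"
proof -
  define S where "S n = (\<Sum>k<n. dist (g (Suc k)) (g k))" for n
  have le: "dist (g i) (g j) \<le> S j - S i" if "i \<le> j" for i j
    using that
  proof (induction j rule: dec_induct)
    case (step j)
    then show ?case
      using dist_triangle2[of "g i" "g (Suc j)" "g j"] by (simp add: S_def)
  qed simp
  have "Cauchy S"
    using assms by (simp add: S_def[abs_def] summable_iff_convergent Cauchy_convergent_iff)
  show ?thesis
  proof (rule CauchyI')
    fix e :: real assume "0 < e"
    then obtain N where N: "\<And>i j. i \<ge> N \<Longrightarrow> j \<ge> N \<Longrightarrow> dist (S i) (S j) < e"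
      using metric_CauchyD[OF \<open>Cauchy S\<close>] by meson
    have "dist (g i) (g j) < e" if "i \<ge> N" "j > i" for i j
      using le[of i j] N[of i j] that by (simp add: dist_real_def)
    then show "\<exists>N. \<forall>i\<ge>N. \<forall>j>i. dist (g i) (g j) < e" by blast
  qed
qed

text \<open>Testing the quasi-Fejer inequality at \<open>z - \<rho> h\<close>, with \<open>h\<close> the direction of the increment of
  \<open>V\<^sub>n (x\<^sub>n - z)\<close>, shows that \<open>V\<^sub>n (x\<^sub>n - z)\<close> has finite length.\<close>

lemma quasi_fejer_strong_if_interior:
  fixes x :: "nat \<Rightarrow> 'a::{real_inner,complete_space}"
  assumes ell: "\<And>n. elliptic m M (V n)" and m: "0 < m" and M: "0 < M"
    and \<eta>: "\<And>n. 0 \<le> \<eta> n" "summable \<eta>" and e: "summable e"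
    and step: "\<And>z n. z \<in> Z \<Longrightarrow> inner (V (Suc n) (x (Suc n) - z)) (x (Suc n) - z)
       \<le> (1 + \<eta> n) * inner (V n (x n - z)) (x n - z) + e n"
    and conv: "\<And>z. z \<in> Z \<Longrightarrow> convergent (\<lambda>n. inner (V n (x n - z)) (x n - z))"
    and weak: "weakly_converges x l" and bdd: "\<And>n. norm (x n) \<le> K"
    and VW: "\<And>z. (\<lambda>n. V n z) \<longlonglongrightarrow> W z"
    and \<nu>: "\<And>n. 0 \<le> \<nu> n" "summable \<nu>"
    and inc: "\<And>n h. inner (V n h) h \<le> (1 + \<nu> n) * inner (V (Suc n) h) h"
    and int: "interior Z \<noteq> {}"
  shows "x \<longlonglongrightarrow> l"
proof -
  obtain z \<rho> where \<rho>: "0 < \<rho>" and ball: "cball z \<rho> \<subseteq> Z"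
    using int mem_interior_cball by blast
  have zZ: "z \<in> Z" using ball \<rho> by auto
  have V0: "0 \<le> inner (V n w) w" for n w
    using elliptic_lower[OF ell, of w n] m by (smt (verit) mult_nonneg_nonneg zero_le_power2)
  define g where "g n = V n (x n - z)" for n
  define s where "s n = inner (V n (x n - z)) (x n - z)" for n
  \<comment> \<open>A bound, uniform in n, for the squared distance from \<open>x n\<close> to the
    shifted zeros \<open>z'\<close> in the ball; it makes the contribution of
    \<open>\<eta> n\<close> summable.\<close>
  define R where "R = M * (K + norm z + \<rho>)\<^sup>2"
  define f where "f n = \<rho>\<^sup>2 * M * \<nu> n + R * \<eta> n + e n" for n
  have len: "2 * \<rho> * norm (g (Suc n) - g n) \<le> (s n - s (Suc n)) + f n" for n
  proof -
    \<comment> \<open>If the increment is 0, then \<open>sgn\<close> gives \<open>h = 0\<close> and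
      the test point is \<open>z\<close> itself.\<close>
    define h where "h = sgn (g (Suc n) - g n)"
    have h1: "norm h \<le> 1" by (simp add: h_def norm_sgn)
    have hg: "inner h (g (Suc n) - g n) = norm (g (Suc n) - g n)"
      by (cases "g (Suc n) = g n")
        (simp_all add: h_def sgn_div_norm power2_norm_eq_inner[symmetric] power2_eq_square)
    define z' where "z' = z - \<rho> *\<^sub>R h"
    have z': "z' \<in> Z" using ball h1 \<rho> by (auto simp: z'_def dist_norm mult_le_cancel_left1 subset_iff)
    \<comment> \<open>Comparing this at n and n + 1 isolates \<open>2 * \<rho>\<close> times the
      length of the increment of \<open>g\<close>. The change of the term quadratic in
      \<open>h\<close> is at most \<open>\<rho>\<^sup>2 * M * \<nu> n\<close>, by the second
      comparison of metrics.\<close>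
    have expand: "inner (V k (x k - z')) (x k - z') = s k + 2 * \<rho> * inner h (g k) + \<rho>\<^sup>2 * inner (V k h) h" for k
    proof -
      have "x k - z' = (x k - z) + \<rho> *\<^sub>R h" by (simp add: z'_def)
      then show ?thesis
        by (simp only: elliptic_add_square[OF ell] elliptic_scale_square[OF ell])
          (simp add: s_def g_def inner_commute)
    qed
    have "norm (x n - z') \<le> norm (x n - z) + norm (\<rho> *\<^sub>R h)"
      using norm_triangle_ineq[of "x n - z" "\<rho> *\<^sub>R h"] by (simp add: z'_def algebra_simps)
    also have "\<dots> \<le> (K + norm z) + \<rho>"
      using bdd[of n] norm_triangle_ineq4[of "x n" z] h1 \<rho> by (intro add_mono) auto
    finally have "(norm (x n - z'))\<^sup>2 \<le> (K + norm z + \<rho>)\<^sup>2" by (intro power_mono) auto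
    then have "inner (V n (x n - z')) (x n - z') \<le> R"
      using elliptic_upper[OF ell, of n "x n - z'"] M unfolding R_def
      by (meson order_trans less_imp_le mult_left_mono)
    then have 1: "\<eta> n * inner (V n (x n - z')) (x n - z') \<le> R * \<eta> n"
      using mult_left_mono[of _ R "\<eta> n"] \<eta>(1)[of n] by (simp add: mult.commute[of R])
    have "inner (V (Suc n) h) h \<le> M * (norm h)\<^sup>2" by (rule elliptic_upper[OF ell])
    also have "\<dots> \<le> M * 1" using M h1 by (intro mult_left_mono) (auto simp: power_le_one)
    finally have "\<nu> n * inner (V (Suc n) h) h \<le> \<nu> n * M" using \<nu>(1)[of n] by (simp add: mult_left_mono)
    then have "inner (V n h) h - inner (V (Suc n) h) h \<le> M * \<nu> n"
      using inc[of n h] by (simp add: algebra_simps)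
    then have "\<rho>\<^sup>2 * (inner (V n h) h - inner (V (Suc n) h) h) \<le> \<rho>\<^sup>2 * (M * \<nu> n)"
      by (rule mult_left_mono) simp
    then have 2: "\<rho>\<^sup>2 * inner (V n h) h - \<rho>\<^sup>2 * inner (V (Suc n) h) h \<le> \<rho>\<^sup>2 * M * \<nu> n"
      by (simp add: right_diff_distrib)
    have 3: "inner (V (Suc n) (x (Suc n) - z')) (x (Suc n) - z')
        \<le> inner (V n (x n - z')) (x n - z') + \<eta> n * inner (V n (x n - z')) (x n - z') + e n"
      using step[OF z', of n] by (simp add: distrib_right)
    have "2 * \<rho> * norm (g (Suc n) - g n) = 2 * \<rho> * inner h (g (Suc n)) - 2 * \<rho> * inner h (g n)"
      unfolding hg[symmetric] by (simp add: inner_diff_right right_diff_distrib)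
    with 1 2 3 show ?thesis unfolding expand[of n] expand[of "Suc n"] f_def by linarith
  qed
  have "summable (\<lambda>n. s n - s (Suc n))"
    using conv[OF zZ] by (auto simp: convergent_def s_def intro: telescope_summable')
  moreover have "summable f" unfolding f_def by (intro summable_add summable_mult \<nu> \<eta> e)
  ultimately have "summable (\<lambda>n. (s n - s (Suc n)) + f n)" by (rule summable_add)
  then have "summable (\<lambda>n. 2 * \<rho> * norm (g (Suc n) - g n))"
    by (rule summable_comparison_test'[where N=0]) (use len \<rho> in auto)
  then have "summable (\<lambda>n. norm (g (Suc n) - g n))" using \<rho> by (simp add: summable_cmult_iff)
  then have "Cauchy g" by (intro Cauchy_if_summable_dist) (simp add: dist_norm)
  then obtain G where G: "g \<longlonglongrightarrow> G" by (auto simp: Cauchy_convergent_iff convergent_def)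
  \<comment> \<open>Strong convergence of \<open>g\<close> does not yet give that of
    \<open>x\<close>. It makes \<open>V n (x n - l)\<close> converge strongly while
    \<open>x n - l\<close> tends weakly to 0, so their inner product vanishes in the limit and
    dominates \<open>m\<close> times the squared norm.\<close>
  have "(\<lambda>n. g n - V n (l - z)) \<longlonglongrightarrow> G - W (l - z)" by (intro tendsto_diff G VW)
  also have "(\<lambda>n. g n - V n (l - z)) = (\<lambda>n. V n (x n - l))"
    by (simp add: g_def elliptic_simps[OF ell])
  finally have Vlim: "(\<lambda>n. V n (x n - l)) \<longlonglongrightarrow> G - W (l - z)" .
  have "weakly_converges (\<lambda>n. x n - l) 0"
    using weak by (auto simp: weakly_converges_def inner_diff_left LIM_zero_iff)
  moreover have "norm (x n - l) \<le> K + norm l" for n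
    using bdd[of n] norm_triangle_ineq4[of "x n" l] by linarith
  ultimately have "(\<lambda>n. inner (x n - l) (V n (x n - l))) \<longlonglongrightarrow> inner 0 (G - W (l - z))"
    using Vlim by (rule tendsto_inner_weak_strong)
  then have lim0: "(\<lambda>n. inner (V n (x n - l)) (x n - l) / m) \<longlonglongrightarrow> 0"
    using m by (auto simp: inner_commute intro!: tendsto_divide_zero)
  have "(norm (x n - l))\<^sup>2 \<le> inner (V n (x n - l)) (x n - l) / m" for n
    using elliptic_lower[OF ell, of "x n - l" n] m by (simp add: pos_le_divide_eq mult.commute)
  then have "(\<lambda>n. (norm (x n - l))\<^sup>2) \<longlonglongrightarrow> 0"
    by (intro Lim_null_comparison[OF _ lim0]) simp
  then have "(\<lambda>n. norm (x n - l)) \<longlonglongrightarrow> 0" using tendsto_real_sqrt[of "\<lambda>n. (norm (x n - l))\<^sup>2" 0] by simp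
  then show ?thesis by (simp add: tendsto_norm_zero_iff LIM_zero_iff)
qed

text \<open>Monotonicity replaces continuity of the modulus: as long as \<open>t n\<close> is at
  least \<delta>, the value \<open>s n\<close> cannot fall below the positive number
  \<open>\<phi> \<delta>\<close>.\<close>

lemma ereal_modulus_tendsto_zero:
  fixes \<phi> :: "real \<Rightarrow> ereal" and t s :: "nat \<Rightarrow> real"
  assumes mono: "mono_on {0..} \<phi>" and nn: "\<forall>t\<ge>0. 0 \<le> \<phi> t" and zero: "\<forall>t\<ge>0. \<phi> t = 0 \<longleftrightarrow> t = 0"
    and t: "\<And>n. 0 \<le> t n" and le: "\<And>n. \<phi> (t n) \<le> ereal (s n)" and s: "s \<longlonglongrightarrow> 0"
  shows "t \<longlonglongrightarrow> 0"
proof (rule order_tendstoI)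
  fix \<delta> :: real assume \<delta>: "0 < \<delta>"
  then have "0 < \<phi> \<delta>" using nn[rule_format, of \<delta>] zero[rule_format, of \<delta>] by (auto simp: less_le)
  moreover have "(\<lambda>n. ereal (s n)) \<longlonglongrightarrow> 0" using s by (simp add: zero_ereal_def)
  ultimately have "eventually (\<lambda>n. ereal (s n) < \<phi> \<delta>) sequentially" by (rule order_tendstoD(2)[rotated])
  then show "eventually (\<lambda>n. t n < \<delta>) sequentially"
  proof eventually_elim
    case (elim n)
    show ?case
    proof (rule ccontr)
      assume "\<not> t n < \<delta>"
      then have "\<phi> \<delta> \<le> \<phi> (t n)" using \<delta> by (intro mono_onD[OF mono]) auto
      with le[of n] elim show False by (meson leD order_trans)
    qed
  qed
qed (use t in \<open>auto intro: always_eventually less_le_trans\<close>)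

section \<open>Convergence of the algorithm\<close>

lemma zer_op_plus_iff: "z \<in> zer (op_plus A B) \<longleftrightarrow> - B z \<in> A z"
proof -
  have "0 = u + B z \<longleftrightarrow> u = - B z" for u by (metis eq_neg_iff_add_eq_0)
  then show ?thesis by (auto simp: zer_def op_plus_def image_iff)
qed

lemma summable_square:
  fixes f :: "nat \<Rightarrow> real"
  assumes "summable f" "\<And>n. 0 \<le> f n"
  shows "summable (\<lambda>n. (f n)\<^sup>2)"
proof (rule summable_comparison_test'[where N=0])
  show "summable (\<lambda>n. suminf f * f n)" using assms by (intro summable_mult)
  have "f n \<le> suminf f" for n using sum_le_suminf[OF assms(1), of "{n}"] assms(2) by simp
  then show "norm ((f n)\<^sup>2) \<le> suminf f * f n" for n
    using assms(2)[of n] by (simp add: power2_eq_square mult_right_mono)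
qed

lemma norm_add_square_le:
  fixes u v :: "'a::real_inner"
  shows "(norm (u + v))\<^sup>2 \<le> 2 * (norm u)\<^sup>2 + 2 * (norm v)\<^sup>2"
  using inner_ge_zero[of "u - v"]
  by (simp add: power2_norm_eq_inner inner_add_left inner_add_right inner_diff_left inner_diff_right inner_commute)

lemma summable_square_tendsto_zero:
  fixes x :: "nat \<Rightarrow> 'a::real_normed_vector"
  assumes "summable (\<lambda>n. (norm (x n))\<^sup>2)"
  shows "x \<longlonglongrightarrow> 0"
  using tendsto_real_sqrt[OF summable_LIMSEQ_zero[OF assms]] by (simp add: tendsto_norm_zero_iff)

theorem theorem3p1:
  fixes A :: "'a::{real_inner, complete_space} \<Rightarrow> 'a set"
    and B :: "'a \<Rightarrow> 'a"
    and U :: "nat \<Rightarrow> ('a \<Rightarrow>\<^sub>L 'a)"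
    and \<eta> \<gamma> :: "nat \<Rightarrow> real"
    and \<alpha> \<beta> \<mu> \<epsilon> :: real
    and a b c x y p q :: "nat \<Rightarrow> 'a"
    and x0 :: 'a
  assumes alpha_pos: "0 < \<alpha>" and beta_pos: "0 < \<beta>"
    and eta_nonneg: "\<forall>n. 0 \<le> \<eta> n" and eta_summable: "summable \<eta>"
    and U_bounded: "bdd_above (range (\<lambda>n. norm (U n)))"
    and mu_def: "\<mu> = (SUP n. norm (U n))"
    and U_P: "\<forall>n. U n \<in> P_alpha \<alpha>"
    and U_var: "\<forall>n. loewner_ge ((1 + \<eta> n) *\<^sub>R U (Suc n)) (U n)"
    and A_max: "maximally_monotone A"
    and B_mono: "monotone_op (single_op B)"
    and B_lip: "\<beta>-lipschitz_on UNIV B"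
    and zer_ne: "zer (op_plus A B) \<noteq> {}"
    and a_sum: "summable (\<lambda>n. norm (a n))"
    and b_sum: "summable (\<lambda>n. norm (b n))"
    and c_sum: "summable (\<lambda>n. norm (c n))"
    and eps: "0 < \<epsilon>" "\<epsilon> < 1 / (\<beta> * \<mu> + 1)"
    and gamma: "\<forall>n. \<epsilon> \<le> \<gamma> n \<and> \<gamma> n \<le> (1 - \<epsilon>) / (\<beta> * \<mu>)"
    and x_0: "x 0 = x0"
    and y_def: "\<forall>n. y n = x n - \<gamma> n *\<^sub>R blinfun_apply (U n) (B (x n) + a n)"
    and p_def: "\<forall>n. p n = resolvent (scaled_op (\<gamma> n) (U n) A) (y n) + b n"
    and q_def: "\<forall>n. q n = p n - \<gamma> n *\<^sub>R blinfun_apply (U n) (B (p n) + c n)"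
    and x_rec: "\<forall>n. x (Suc n) = x n - y n + q n"
  shows "\<exists>xbar \<in> zer (op_plus A B).
     summable (\<lambda>n. (norm (x n - p n))\<^sup>2) \<and> summable (\<lambda>n. (norm (y n - q n))\<^sup>2) \<and>
     weakly_converges x xbar \<and> weakly_converges p xbar \<and>
     ((liminf (\<lambda>n. ereal (infdist (x n) (zer (op_plus A B)))) = 0
       \<or> demiregular_at (op_plus A B) xbar
       \<or> uniformly_monotone_at A xbar \<or> uniformly_monotone_at (single_op B) xbar
       \<or> (interior (zer (op_plus A B)) \<noteq> {} \<and>
          (\<exists>\<nu>::nat \<Rightarrow> real. (\<forall>n. 0 \<le> \<nu> n) \<and> summable \<nu> \<and>
             (\<forall>n. loewner_ge ((1 + \<nu> n) *\<^sub>R U n) (U (Suc n))))))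
      \<longrightarrow> x \<longlonglongrightarrow> xbar \<and> p \<longlonglongrightarrow> xbar)"
proof -

  \<comment> \<open>Constants and metrics of the iteration\<close>
  have \<mu>_nonneg: "0 \<le> \<mu>" and U_le: "norm (U n) \<le> \<mu>" for n
    using order_trans[OF norm_ge_zero cSUP_upper[OF UNIV_I U_bounded]] cSUP_upper[OF UNIV_I U_bounded]
    unfolding mu_def by blast+
  \<comment> \<open>For \<mu> = 0 the upper bound on the step size is a division by zero, hence 0,
    which contradicts its positive lower bound.\<close>
  have \<mu>: "0 < \<mu>"
    using gamma[rule_format, of 0] eps(1) \<mu>_nonneg by (cases "\<mu> = 0") auto
  have eps1: "\<epsilon> < 1"
  proof -
    have "0 < \<beta> * \<mu>" using \<mu> beta_pos by simp
    then have "1 / (\<beta> * \<mu> + 1) \<le> 1" by (simp add: divide_le_eq)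
    with eps(2) show ?thesis by linarith
  qed
  have g\<epsilon>: "\<epsilon> \<le> \<gamma> n" and g: "0 < \<gamma> n" and g\<mu>: "\<gamma> n * \<beta> * \<mu> \<le> 1 - \<epsilon>" for n
    using gamma[rule_format, of n] eps(1) \<mu> beta_pos by (auto simp: field_simps)
  have g\<mu>1: "\<gamma> n * \<beta> * \<mu> \<le> 1" for n using g\<mu>[of n] eps(1) by linarith
  have L: "elliptic \<alpha> \<mu> (blinfun_apply (U n))" for n
    unfolding elliptic_def
  proof (intro conjI allI)
    show "linear (blinfun_apply (U n))"
      by (simp add: blinfun.bounded_linear_right bounded_linear.linear)
    fix x y
    show "inner (U n x) y = inner x (U n y)"
      using U_P[rule_format, of n] by (simp add: P_alpha_def selfadjoint_def)
    show "\<alpha> * (norm x)\<^sup>2 \<le> inner (U n x) x"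
      using U_P[rule_format, of n]
      by (simp add: P_alpha_def loewner_ge_def blinfun.bilinear_simps power2_norm_eq_inner)
    show "norm (U n x) \<le> \<mu> * norm x"
      using norm_blinfun[of "U n" x] U_le[of n] by (meson mult_right_mono norm_ge_zero order_trans)
  qed
  define V where "V n = inv (blinfun_apply (U n))" for n
  have V: "elliptic (1 / \<mu>) (1 / \<alpha>) (V n)" for n
    unfolding V_def by (rule elliptic_inv[OF L alpha_pos \<mu>])
  have LV: "U n (V n w) = w" and VL: "V n (U n w) = w" for n w
    by (simp_all add: V_def elliptic_inv_apply[OF L alpha_pos])
  have V0: "0 \<le> inner (V n w) w" for n w
    using elliptic_lower[OF V, of w n] \<mu> by (smt (verit) divide_nonneg_nonneg mult_nonneg_nonneg zero_le_power2)
  have Vmono: "inner (V (Suc n) w) w \<le> (1 + \<eta> n) * inner (V n w) w" for n w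
    unfolding V_def
  proof (rule elliptic_inv_antimono[OF L L alpha_pos alpha_pos])
    show "0 < 1 + \<eta> n" using eta_nonneg by (simp add: add_pos_nonneg)
    show "inner (U n w) w \<le> (1 + \<eta> n) * inner (U (Suc n) w) w" for w
      using U_var by (simp add: loewner_ge_def blinfun.bilinear_simps)
  qed
  have Bl: "norm (B w - B w') \<le> \<beta> * norm (w - w')" for w w'
    using lipschitz_onD[OF B_lip, of w w'] by (simp add: dist_norm)
  have Bm: "0 \<le> inner (w - w') (B w - B w')" for w w'
    using B_mono by (simp add: monotone_op_def single_op_def)
  have A_mono: "monotone_op A" using A_max by (simp add: maximally_monotone_def)

  \<comment> \<open>Exact companions of the iterates and error bounds\<close>
  define Z where "Z = zer (op_plus A B)"
  have Z_iff: "z \<in> Z \<longleftrightarrow> - B z \<in> A z" for z unfolding Z_def by (rule zer_op_plus_iff)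
  \<comment> \<open>The exact step restarts from the actual \<open>x n\<close> at every index, so
    errors do not accumulate inside the comparison.\<close>
  define y' where "y' n = x n - \<gamma> n *\<^sub>R U n (B (x n))" for n
  define p' where "p' n = resolvent (scaled_op (\<gamma> n) (U n) A) (y' n)" for n
  define u where "u n = (1 / \<gamma> n) *\<^sub>R V n (y' n - p' n)" for n
  define v where "v n = u n + B (p' n)" for n
  define x' where "x' n = p' n + \<gamma> n *\<^sub>R U n (B (x n) - B (p' n))" for n
  define e where "e n = norm (a n) + norm (b n) + norm (c n)" for n
  define C where "C = 2 * (\<mu> / (\<alpha> * \<beta>) + 1) + 1 / \<beta>"
  have e: "0 \<le> e n" "summable e" for n
    using a_sum b_sum c_sum unfolding e_def by (auto intro: summable_add)
  have C: "0 \<le> C" using \<mu> alpha_pos beta_pos by (simp add: C_def)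
  have uA: "u n \<in> A (p' n)" for n
    unfolding u_def p'_def V_def by (rule resolvent_scaled[OF A_max L alpha_pos \<mu> g])
  \<comment> \<open>The exact resolvent at the perturbed \<open>y n\<close>: it lies between
    \<open>p n\<close>, from which it differs by \<open>b n\<close>, and \<open>p' n\<close>, from
    which it differs only through \<open>a n\<close>.\<close>
  define p0 where "p0 n = resolvent (scaled_op (\<gamma> n) (U n) A) (y n)" for n
  have p0A: "(1 / \<gamma> n) *\<^sub>R V n (y n - p0 n) \<in> A (p0 n)" for n
    unfolding p0_def V_def by (rule resolvent_scaled[OF A_max L alpha_pos \<mu> g])
  note err = fbf_error[OF L V \<mu> beta_pos g alpha_pos g\<mu>1 Bl A_mono uA[unfolded u_def] y'_def p0A
      y_def[rule_format] p_def[rule_format, folded p0_def] q_def[rule_format] C_def, folded x'_def e_def]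
  have pp': "norm (p n - p' n) \<le> C * e n" for n by (rule err(1))
  have xx': "norm (x (Suc n) - x' n) \<le> C * e n" for n
    unfolding x_rec[rule_format] by (rule err(2))
  have gU: "norm (\<gamma> n *\<^sub>R U n w) \<le> norm w / \<beta>" for n w by (rule err(3))
  note step = fbf_step[OF L V LV VL \<mu> beta_pos g g\<mu> Bl v_def[unfolded u_def y'_def] x'_def]

  \<comment> \<open>The quasi-Fejer inequality\<close>
  define \<kappa> where "\<kappa> = (1 - (1 - \<epsilon>)\<^sup>2) / \<mu>"
  have "(1 - \<epsilon>)\<^sup>2 < 1" using eps(1) eps1 by (simp add: power_less_one_iff abs_less_iff)
  then have \<kappa>: "0 < \<kappa>" using \<mu> by (simp add: \<kappa>_def)
  define H where "H = suminf \<eta>"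
  have \<eta>H: "\<eta> n \<le> H" for n
    using sum_le_suminf[OF eta_summable, of "{n}"] eta_nonneg by (simp add: H_def)
  have H: "0 \<le> H" using \<eta>H[of 0] eta_nonneg order_trans by blast
  \<comment> \<open>This is (1 + \<eta>)(1 + e) - 1, the joint cost of changing the metric and of
    Young's inequality. In \<open>e'\<close> the factor 1 + H majorizes 1 + \<eta>, by which the
    change of metric multiplies the additive error.\<close>
  define \<eta>' where "\<eta>' n = \<eta> n + e n + \<eta> n * e n" for n
  define e' where "e' n = (1 + H) * (1 / \<alpha> * C\<^sup>2 * (e n + (e n)\<^sup>2))" for n
  have e2: "summable (\<lambda>n. (e n)\<^sup>2)" using e by (intro summable_square)
  have e': "0 \<le> e' n" "summable e'" for n
    using e H alpha_pos e2 unfolding e'_def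
    by (auto intro!: mult_nonneg_nonneg summable_mult summable_add)
  have "summable (\<lambda>n. \<eta> n * e n)"
  proof (rule summable_comparison_test'[where N=0])
    show "summable (\<lambda>n. H * e n)" using e by (intro summable_mult)
    show "norm (\<eta> n * e n) \<le> H * e n" for n
      using \<eta>H[of n] e(1)[of n] eta_nonneg by (simp add: abs_mult mult_right_mono)
  qed
  then have \<eta>': "0 \<le> \<eta>' n" "summable \<eta>'" for n
    using e eta_nonneg eta_summable unfolding \<eta>'_def by (auto intro!: summable_add)
  have fejer: "inner (V (Suc n) (x (Suc n) - z)) (x (Suc n) - z)
      \<le> (1 + \<eta>' n) * inner (V n (x n - z)) (x n - z) - \<kappa> * (norm (x n - p' n))\<^sup>2 + e' n"
    if z: "z \<in> Z" for z n
  proof -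
    let ?s = "inner (V n (x n - z)) (x n - z)" and ?d = "\<kappa> * (norm (x n - p' n))\<^sup>2"
    let ?w = "inner (V n (x' n - z)) (x' n - z)" and ?k = "1 / \<alpha> * C\<^sup>2 * (e n + (e n)\<^sup>2)"
    have "0 \<le> inner (p' n - z) (u n - (- B z))"
      using z unfolding Z_iff by (intro maximally_monotoneD[OF A_max uA])
    with Bm[of "p' n" z] have "0 \<le> inner (p' n - z) (v n)"
      by (simp add: v_def inner_diff_right inner_add_right)
    then have "0 \<le> 2 * \<gamma> n * inner (p' n - z) (v n)" using g[of n] by simp
    with step(1)[of n z] have w: "?w \<le> ?s - ?d" by (simp add: \<kappa>_def)
    have d0: "0 \<le> ?d" using \<kappa> by simp
    have "inner (V (Suc n) (x (Suc n) - z)) (x (Suc n) - z)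
        \<le> (1 + \<eta> n) * inner (V n (x (Suc n) - z)) (x (Suc n) - z)" by (rule Vmono)
    also have "\<dots> \<le> (1 + \<eta> n) * ((1 + e n) * (?s - ?d) + ?k)"
    proof (rule mult_left_mono)
      have "inner (V n ((x' n - z) + (x (Suc n) - x' n))) ((x' n - z) + (x (Suc n) - x' n))
          \<le> (1 + e n) * ?w + ?k"
        using \<mu> alpha_pos C e xx' by (intro elliptic_perturb[OF V]) auto
      also have "(1 + e n) * ?w \<le> (1 + e n) * (?s - ?d)"
        using w e(1)[of n] by (intro mult_left_mono) auto
      finally show "inner (V n (x (Suc n) - z)) (x (Suc n) - z) \<le> (1 + e n) * (?s - ?d) + ?k" by simp
    qed (use eta_nonneg in simp)
    also have "(1 + \<eta> n) * ((1 + e n) * (?s - ?d) + ?k) = (1 + \<eta>' n) * ?s - (1 + \<eta>' n) * ?d + (1 + \<eta> n) * ?k"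
      by (simp add: \<eta>'_def algebra_simps)
    also have "(1 + \<eta> n) * ?k \<le> e' n"
      unfolding e'_def using \<eta>H[of n] alpha_pos e(1)[of n] by (intro mult_right_mono) auto
    finally have "inner (V (Suc n) (x (Suc n) - z)) (x (Suc n) - z)
        \<le> (1 + \<eta>' n) * ?s - (1 + \<eta>' n) * ?d + e' n" by simp
    moreover have "1 * ?d \<le> (1 + \<eta>' n) * ?d" using \<eta>'(1)[of n] d0 by (intro mult_right_mono) auto
    ultimately show ?thesis by linarith
  qed
  have fejer': "inner (V (Suc n) (x (Suc n) - z)) (x (Suc n) - z)
      \<le> (1 + \<eta>' n) * inner (V n (x n - z)) (x n - z) + e' n" if "z \<in> Z" for z n
  proof -
    have "0 \<le> \<kappa> * (norm (x n - p' n))\<^sup>2" using \<kappa> by simp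
    with fejer[OF that, of n] show ?thesis by linarith
  qed
  have rs: "convergent (\<lambda>n. inner (V n (x n - z)) (x n - z))"
      "summable (\<lambda>n. \<kappa> * (norm (x n - p' n))\<^sup>2)" if "z \<in> Z" for z
    using robbins_siegmund[where s="\<lambda>n. inner (V n (x n - z)) (x n - z)"
        and d="\<lambda>n. \<kappa> * (norm (x n - p' n))\<^sup>2" and \<eta>=\<eta>' and e=e']
      V0 \<kappa> \<eta>' e' fejer[OF that] by auto

  \<comment> \<open>Square summability and vanishing residuals\<close>
  obtain z0 where z0: "z0 \<in> Z" using zer_ne by (auto simp: Z_def)
  have xp'_sum: "summable (\<lambda>n. (norm (x n - p' n))\<^sup>2)"
    using rs(2)[OF z0] \<kappa> by (simp add: summable_cmult_iff)
  then have xp'_lim: "(\<lambda>n. x n - p' n) \<longlonglongrightarrow> 0" by (rule summable_square_tendsto_zero)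
  have Ce2: "summable (\<lambda>n. 2 * (C * e n)\<^sup>2)"
    using e2 by (intro summable_mult) (simp add: power_mult_distrib summable_mult)
  have xp_sum: "summable (\<lambda>n. (norm (x n - p n))\<^sup>2)"
  proof (rule summable_comparison_test'[where N=0])
    show "summable (\<lambda>n. 2 * (norm (x n - p' n))\<^sup>2 + 2 * (C * e n)\<^sup>2)"
      using xp'_sum Ce2 by (intro summable_add summable_mult[of "\<lambda>n. (norm (x n - p' n))\<^sup>2"])
    fix n
    have "(norm (p' n - p n))\<^sup>2 \<le> (C * e n)\<^sup>2"
      using pp'[of n] by (intro power_mono) (auto simp: norm_minus_commute)
    then show "norm ((norm (x n - p n))\<^sup>2) \<le> 2 * (norm (x n - p' n))\<^sup>2 + 2 * (C * e n)\<^sup>2"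
      using norm_add_square_le[of "x n - p' n" "p' n - p n"] by simp
  qed
  have xx'_le: "norm (x n - x' n) \<le> 2 * norm (x n - p' n)" for n
  proof -
    have "norm (\<gamma> n *\<^sub>R U n (B (x n) - B (p' n))) \<le> norm (B (x n) - B (p' n)) / \<beta>" by (rule gU)
    also have "\<dots> \<le> norm (x n - p' n)"
      using Bl[of "x n" "p' n"] beta_pos by (simp add: divide_le_eq mult.commute)
    finally show ?thesis
      using norm_triangle_ineq4[of "x n - p' n" "\<gamma> n *\<^sub>R U n (B (x n) - B (p' n))"]
      by (simp add: x'_def algebra_simps)
  qed
  \<comment> \<open>\<open>y n - q n\<close> is the whole step \<open>x n - x (Suc n)\<close>. The 8
    is 2 from splitting the square times the square of the factor 2 in
    \<open>xx'_le\<close>.\<close>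
  have yq_sum: "summable (\<lambda>n. (norm (y n - q n))\<^sup>2)"
  proof (rule summable_comparison_test'[where N=0])
    show "summable (\<lambda>n. 8 * (norm (x n - p' n))\<^sup>2 + 2 * (C * e n)\<^sup>2)"
      using xp'_sum Ce2 by (intro summable_add summable_mult[of "\<lambda>n. (norm (x n - p' n))\<^sup>2"])
    fix n
    have "(norm (x' n - x (Suc n)))\<^sup>2 \<le> (C * e n)\<^sup>2"
      using xx'[of n] by (intro power_mono) (auto simp: norm_minus_commute)
    moreover have "(norm (x n - x' n))\<^sup>2 \<le> (2 * norm (x n - p' n))\<^sup>2"
      using xx'_le by (intro power_mono) auto
    moreover have "y n - q n = (x n - x' n) + (x' n - x (Suc n))" by (simp add: x_rec)
    ultimately show "norm ((norm (y n - q n))\<^sup>2) \<le> 8 * (norm (x n - p' n))\<^sup>2 + 2 * (C * e n)\<^sup>2"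
      using norm_add_square_le[of "x n - x' n" "x' n - x (Suc n)"] by (simp add: power_mult_distrib)
  qed
  \<comment> \<open>The exact step equals \<open>\<gamma> n\<close> times \<open>U n (v n)\<close>;
    the lower bound \<epsilon> on \<open>\<gamma> n\<close> allows the division.\<close>
  have v_lim: "v \<longlonglongrightarrow> 0"
  proof (rule Lim_null_comparison)
    show "\<forall>\<^sub>F n in sequentially. norm (v n) \<le> (2 / (\<epsilon> * \<alpha>)) * norm (x n - p' n)"
    proof (intro always_eventually allI)
      fix n
      have "\<epsilon> * norm (v n) \<le> \<gamma> n * norm (v n)" using g\<epsilon> by (intro mult_right_mono) auto
      also have "\<dots> = norm (V n (x n - x' n))" using step(2)[of n] g[of n] by simp
      also have "\<dots> \<le> 1 / \<alpha> * norm (x n - x' n)" by (rule elliptic_norm[OF V])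
      also have "\<dots> \<le> 1 / \<alpha> * (2 * norm (x n - p' n))"
        using alpha_pos xx'_le by (intro mult_left_mono) auto
      finally show "norm (v n) \<le> (2 / (\<epsilon> * \<alpha>)) * norm (x n - p' n)"
        using eps(1) alpha_pos by (simp add: field_simps)
    qed
    show "(\<lambda>n. (2 / (\<epsilon> * \<alpha>)) * norm (x n - p' n)) \<longlonglongrightarrow> 0"
      by (intro tendsto_mult_right_zero tendsto_norm_zero xp'_lim)
  qed
  obtain K where K: "\<And>n. norm (x n) \<le> K"
  proof -
    obtain S where S: "\<And>n. inner (V n (x n - z0)) (x n - z0) \<le> S"
      using convergent_imp_Bseq[OF rs(1)[OF z0]] by (auto simp: Bseq_def abs_le_iff)
    have "norm (x n) \<le> sqrt (\<mu> * S) + norm z0" for n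
    proof -
      have "(norm (x n - z0))\<^sup>2 / \<mu> \<le> S"
        by (rule order_trans[OF _ S[of n]]) (use elliptic_lower[OF V, of "x n - z0" n] in simp)
      then have "(norm (x n - z0))\<^sup>2 \<le> \<mu> * S" using \<mu> by (simp add: divide_le_eq mult.commute)
      then have "norm (x n - z0) \<le> sqrt (\<mu> * S)" by (rule real_le_rsqrt)
      then show ?thesis using norm_triangle_ineq2[of "x n" z0] by linarith
    qed
    then show ?thesis using that by blast
  qed
  obtain K' where K': "\<And>n. norm (p' n) \<le> K'"
  proof -
    obtain T where T: "\<And>n. norm (x n - p' n) \<le> T"
      using convergent_imp_Bseq[of "\<lambda>n. x n - p' n"] xp'_lim by (auto simp: Bseq_def convergent_def)
    have "norm (p' n) \<le> norm (x n) + norm (x n - p' n)" for n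
      using norm_triangle_ineq4[of "x n" "x n - p' n"] by simp
    then have "norm (p' n) \<le> K + T" for n using K[of n] T[of n] by (meson add_mono order_trans)
    then show ?thesis using that by blast
  qed

  \<comment> \<open>Weak convergence\<close>
  obtain W where ellW: "elliptic (1 / \<mu>) (1 / \<alpha>) W" and VW: "\<And>w. (\<lambda>n. V n w) \<longlonglongrightarrow> W w"
    using elliptic_strong_limit[OF V _ _ _ eta_summable Vmono] \<mu> alpha_pos eta_nonneg by auto
  \<comment> \<open>Along the subsequence \<open>p'\<close> converges weakly and \<open>v\<close>
    strongly, so monotonicity of A + B against a fixed graph point survives in the limit: the pair
    \<open>(z, 0)\<close> is monotonically related to the graph.\<close>
  have cluster: "z \<in> Z" if r: "strict_mono r" and xz: "weakly_converges (x \<circ> r) z" for r z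
  proof -
    have "(\<lambda>n. (x \<circ> r) n - (p' \<circ> r) n) \<longlonglongrightarrow> 0"
      using LIMSEQ_subseq_LIMSEQ[OF xp'_lim r] by (simp add: o_def)
    then have p'z: "weakly_converges (p' \<circ> r) z" by (rule weakly_converges_perturb[OF xz])
    have "0 \<le> inner (z - t) (- (w + B t))" if w: "w \<in> A t" for t w
    proof -
      have "weakly_converges (\<lambda>n. p' (r n) - t) (z - t)"
        using p'z by (auto simp: weakly_converges_def inner_diff_left o_def intro!: tendsto_diff)
      moreover have "norm (p' (r n) - t) \<le> K' + norm t" for n
        using norm_triangle_ineq4[of "p' (r n)" t] K'[of "r n"] by linarith
      moreover have "(\<lambda>n. v (r n) - (w + B t)) \<longlonglongrightarrow> 0 - (w + B t)"
        using LIMSEQ_subseq_LIMSEQ[OF v_lim r] by (intro tendsto_diff) (auto simp: o_def)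
      ultimately have lim: "(\<lambda>n. inner (p' (r n) - t) (v (r n) - (w + B t))) \<longlonglongrightarrow> inner (z - t) (0 - (w + B t))"
        by (rule tendsto_inner_weak_strong)
      have "0 \<le> inner (p' (r n) - t) (v (r n) - (w + B t))" for n
        using maximally_monotoneD[OF A_max uA w, of "r n"] Bm[of "p' (r n)" t]
        by (simp add: v_def inner_diff_right inner_add_right)
      then show ?thesis using LIMSEQ_le_const[OF lim, of 0] by auto
    qed
    then show "z \<in> Z" unfolding Z_iff by (rule maximally_monotone_plus_zero[OF A_max B_lip])
  qed
  have "\<exists>l\<in>Z. weakly_converges x l"
    by (rule opial_variable_metric[OF V ellW _ VW K rs(1) cluster]) (use \<mu> in simp_all)
  then obtain l where lZ: "l \<in> Z" and xl: "weakly_converges x l" by blast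
  have xp_lim: "(\<lambda>n. x n - p n) \<longlonglongrightarrow> 0" using xp_sum by (rule summable_square_tendsto_zero)
  have pl: "weakly_converges p l" by (rule weakly_converges_perturb[OF xl xp_lim])
  have p'l: "weakly_converges p' l" by (rule weakly_converges_perturb[OF xl xp'_lim])

  \<comment> \<open>Strong convergence\<close>
  have vmem: "v n \<in> op_plus A B (p' n)" for n using uA[of n] by (simp add: op_plus_def v_def)
  have x_if_p': "x \<longlonglongrightarrow> l" if "p' \<longlonglongrightarrow> l"
    using tendsto_add[OF that xp'_lim] by simp
  have inner_lim: "(\<lambda>n. inner (p' n - l) (v n)) \<longlonglongrightarrow> 0"
  proof -
    have "weakly_converges (\<lambda>n. p' n - l) 0"
      using p'l by (auto simp: weakly_converges_def inner_diff_left LIM_zero_iff)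
    moreover have "norm (p' n - l) \<le> K' + norm l" for n
      using norm_triangle_ineq4[of "p' n" l] K'[of n] by linarith
    ultimately have "(\<lambda>n. inner (p' n - l) (v n)) \<longlonglongrightarrow> inner (0::'a) 0"
      using v_lim by (rule tendsto_inner_weak_strong)
    then show ?thesis by simp
  qed
  \<comment> \<open>A common reduction for uniform monotonicity of \<open>A\<close> or of
    \<open>B\<close>: the modulus comes from one of the two operators, and the other contributes a
    nonnegative term. The right-hand side tends to 0 by \<open>inner_lim\<close>.\<close>
  have p'_if_modulus: "p' \<longlonglongrightarrow> l"
    if \<phi>: "mono_on {0..} \<phi>" "\<forall>t\<ge>0. 0 \<le> \<phi> t" "\<forall>t\<ge>0. \<phi> t = 0 \<longleftrightarrow> t = 0"
      and le: "\<And>n. \<phi> (norm (l - p' n)) \<le> ereal (inner (p' n - l) (v n))" for \<phi> :: "real \<Rightarrow> ereal"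
  proof -
    have "(\<lambda>n. norm (l - p' n)) \<longlonglongrightarrow> 0"
      by (rule ereal_modulus_tendsto_zero[OF \<phi> _ le inner_lim]) simp
    then have "(\<lambda>n. l - p' n) \<longlonglongrightarrow> 0" by (simp add: tendsto_norm_zero_iff)
    from tendsto_diff[OF tendsto_const[of l] this] show ?thesis by simp
  qed
  have lA: "- B l \<in> A l" using lZ by (simp add: Z_iff)
  have strong: "x \<longlonglongrightarrow> l"
    if "liminf (\<lambda>n. ereal (infdist (x n) Z)) = 0 \<or> demiregular_at (op_plus A B) l
       \<or> uniformly_monotone_at A l \<or> uniformly_monotone_at (single_op B) l
       \<or> (interior Z \<noteq> {} \<and> (\<exists>\<nu>::nat \<Rightarrow> real. (\<forall>n. 0 \<le> \<nu> n) \<and> summable \<nu> \<and>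
             (\<forall>n. loewner_ge ((1 + \<nu> n) *\<^sub>R U n) (U (Suc n)))))"
    using that
  proof (elim disjE)
    assume "liminf (\<lambda>n. ereal (infdist (x n) Z)) = 0"
    then show ?thesis
      using z0 \<mu> alpha_pos by (intro quasi_fejer_strong_if_infdist[OF V _ _ \<eta>' e' fejer' _ xl]) auto
  next
    assume "demiregular_at (op_plus A B) l"
    moreover have "0 \<in> op_plus A B l" using lZ by (simp add: Z_def zer_def)
    ultimately have "p' \<longlonglongrightarrow> l" unfolding demiregular_at_def using vmem p'l v_lim by blast
    then show ?thesis by (rule x_if_p')
  next
    assume "uniformly_monotone_at A l"
    then obtain \<phi> :: "real \<Rightarrow> ereal" where \<phi>: "mono_on {0..} \<phi>" "\<forall>t\<ge>0. 0 \<le> \<phi> t" "\<forall>t\<ge>0. \<phi> t = 0 \<longleftrightarrow> t = 0"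
      and um: "\<And>u y v. u \<in> A l \<Longrightarrow> v \<in> A y \<Longrightarrow> \<phi> (norm (l - y)) \<le> ereal (inner (l - y) (u - v))"
      unfolding uniformly_monotone_at_def by blast
    have "inner (l - p' n) (- B l - u n) \<le> inner (p' n - l) (v n)" for n
      using Bm[of "p' n" l] by (simp add: v_def inner_diff_left inner_diff_right inner_add_right)
    then have "\<phi> (norm (l - p' n)) \<le> ereal (inner (p' n - l) (v n))" for n
      using um[OF lA uA[of n]] by (meson ereal_less_eq(3) order_trans)
    then show ?thesis by (intro x_if_p' p'_if_modulus[OF \<phi>])
  next
    assume "uniformly_monotone_at (single_op B) l"
    then obtain \<phi> :: "real \<Rightarrow> ereal" where \<phi>: "mono_on {0..} \<phi>" "\<forall>t\<ge>0. 0 \<le> \<phi> t" "\<forall>t\<ge>0. \<phi> t = 0 \<longleftrightarrow> t = 0"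
      and um: "\<And>y. \<phi> (norm (l - y)) \<le> ereal (inner (l - y) (B l - B y))"
      unfolding uniformly_monotone_at_def single_op_def by blast
    have "inner (l - p' n) (B l - B (p' n)) \<le> inner (p' n - l) (v n)" for n
      using maximally_monotoneD[OF A_max uA lA, of n]
      by (simp add: v_def inner_diff_left inner_diff_right inner_add_right)
    then have "\<phi> (norm (l - p' n)) \<le> ereal (inner (p' n - l) (v n))" for n
      using um[of "p' n"] by (meson ereal_less_eq(3) order_trans)
    then show ?thesis by (intro x_if_p' p'_if_modulus[OF \<phi>])
  next
    assume "interior Z \<noteq> {} \<and> (\<exists>\<nu>::nat \<Rightarrow> real. (\<forall>n. 0 \<le> \<nu> n) \<and> summable \<nu> \<and>
             (\<forall>n. loewner_ge ((1 + \<nu> n) *\<^sub>R U n) (U (Suc n))))"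
    then obtain \<nu> :: "nat \<Rightarrow> real" where int: "interior Z \<noteq> {}"
      and \<nu>: "\<And>n. 0 \<le> \<nu> n" "summable \<nu>" and U\<nu>: "\<And>n. loewner_ge ((1 + \<nu> n) *\<^sub>R U n) (U (Suc n))"
      by blast
    \<comment> \<open>The extra hypothesis of (d) compares consecutive metrics in the direction
      opposite to \<open>Vmono\<close>.\<close>
    have "inner (V n h) h \<le> (1 + \<nu> n) * inner (V (Suc n) h) h" for n h
      unfolding V_def
    proof (rule elliptic_inv_antimono[OF L L alpha_pos alpha_pos])
      show "0 < 1 + \<nu> n" using \<nu>(1) by (simp add: add_pos_nonneg)
      show "inner (U (Suc n) w) w \<le> (1 + \<nu> n) * inner (U n w) w" for w
        using U\<nu> by (simp add: loewner_ge_def blinfun.bilinear_simps)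
    qed
    then show ?thesis
      using \<mu> alpha_pos
      by (intro quasi_fejer_strong_if_interior[OF V _ _ \<eta>' e'(2) fejer' rs(1) xl K VW \<nu> _ int]) auto
  qed
  have p_if_x: "p \<longlonglongrightarrow> l" if "x \<longlonglongrightarrow> l"
    using tendsto_diff[OF that xp_lim] by simp
  show ?thesis
    by (intro bexI[of _ l] conjI impI xp_sum yq_sum xl pl strong[unfolded Z_def] p_if_x; (assumption | fact lZ[unfolded Z_def]))
qed

end
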